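(* Let $S,\Sigma\subset\Omega$ be measurable with $0<\mu(S),\mu(\Sigma)<\infty$, let $\varepsilon,\varepsilon_0\in(0,1)$, and for $f\in L^2(\Omega,\mu)$ let $f_{\mathrm{ker}}$ denote the orthogonal projection of $f$ onto the kernel of $L_{S,\Sigma}$. (1) A function $f\in L^2(\Omega,\mu)$ is in $L^2(\varepsilon,S,\Sigma)$ if and only if $$\sum_{n=1}^{n(\varepsilon,S,\Sigma)}(\lambda_n+\varepsilon-1)\,|\langle f,\varphi_n\rangle_\mu|^2\ge(1-\varepsilon)\|f_{\mathrm{ker}}\|_{2,\mu}^2+\sum_{n=1+n(\varepsilon,S,\Sigma)}^{\infty}(1-\varepsilon-\lambda_n)\,|\langle f,\varphi_n\rangle_\mu|^2.$$ (2) If $f$ is in $L^2(\varepsilon,S,\Sigma)$, then $$\left\|f-\sum_{n=1}^{n(\varepsilon_0,S,\Sigma)}\langle f,\varphi_n\rangle_\mu\,\varphi_n\right\|_{2,\mu}\le\sqrt{\frac{\varepsilon}{\varepsilon_0}}\;\|f\|_{2,\mu}.$$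
   Context: Setting: $\Omega\subset\mathbb{R}^d$ is a convex cone ($\lambda x\in\Omega$ for all $\lambda>0$, $x\in\Omega$) with non-empty interior, endowed with a Borel measure $\mu$, absolutely continuous with respect to Lebesgue measure, with polar decomposition $d\mu(r\zeta)=r^{2a-1}\,dr\,Q(\zeta)\,d\omega(\zeta)$, where $a>0$, $d\omega$ is the surface measure on the unit sphere $\mathbb{S}^{d-1}$, and $Q\in L^1(\mathbb{S}^{d-1},d\omega)$, $Q\ne 0$ (so $\mu$ is homogeneous of degree $2a$). $\|\cdot\|_{p,\mu}$ is the norm of $L^p(\Omega,\mu)$ and $\langle f,g\rangle_\mu=\int_\Omega f\overline{g}\,d\mu$. The kernel $\mathcal{K}:\Omega\times\Omega\to\mathbb{C}$ is continuous, bounded ($|\mathcal{K}(x,\xi)|\le c_{\mathcal{K}}$) and homogeneous ($\mathcal{K}(\lambda x,\xi)=\mathcal{K}(x,\lambda\xi)$ for $\lambda>0$). The operator $\mathcal{T}$ is $\mathcal{T}f(\xi)=\int_\Omega f(x)\mathcal{K}(x,\xi)\,d\mu(x)$. It is assumed that (i) (inversion) if $f,\mathcal{T}f\in L^1(\Omega,\mu)$ then $f$ is continuous and $f(x)=\int_\Omega\mathcal{T}f(\xi)\overline{\mathcal{K}(x,\xi)}\,d\mu(\xi)$ for almost every $x$; (ii) (Parseval) $\langle\mathcal{T}f,\mathcal{T}g\rangle_\mu=\langle f,g\rangle_\mu$ for Schwartz functions $f,g$ on $\Omega$; in particular $\mathcal{T}$ extends to a unitary operator of $L^2(\Omega,\mu)$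 onto itself, with $\mathcal{T}^{-1}f=\overline{\mathcal{T}\overline{f}}$. For measurable $A\subset\Omega$, $E_Af=\chi_Af$ and $F_Af=\mathcal{T}^{-1}[\chi_A\mathcal{T}f]$ on $L^2(\Omega,\mu)$. The phase space restriction operator is $L_{S,\Sigma}=E_SF_\Sigma E_S$; it is a compact (trace class), positive, self-adjoint operator on $L^2(\Omega,\mu)$. Write $L_{S,\Sigma}f=\sum_{n=1}^\infty\lambda_n\langle f,\varphi_n\rangle_\mu\varphi_n$, where $\lambda_1\ge\lambda_2\ge\cdots$ are its positive eigenvalues counted with multiplicity in non-increasing order and $\{\varphi_n\}$ is a corresponding orthonormal set of eigenfunctions. $n(\varepsilon,S,\Sigma)=\operatorname{card}\{n:\lambda_n\ge1-\varepsilon\}$. $L^2(\varepsilon,S,\Sigma)=\{f\in L^2(\Omega,\mu):\langle f-L_{S,\Sigma}f,f\rangle_\mu\le\varepsilon\|f\|_{2,\mu}^2\}$. *)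

theory Defs
  imports "HOL-Analysis.Analysis" "HOL-Library.Extended_Nat"
begin

section \<open>Polar coordinates\<close>

text \<open>Surface measure on the unit sphere, as the cone measure: the surface area of a Borel set
  \<open>A\<close> is \<open>d\<close> times the volume of \<open>{r \<zeta> | \<zeta> \<in> A, 0 < r \<le> 1}\<close>.
  Recall \<open>sgn x = x /\<^sub>R norm x\<close>.\<close>

definition sphere_measure :: "(real ^ 'd) measure" where
  "sphere_measure =
     scale_measure (of_nat CARD('d))
       (distr (restrict_space lborel (cball 0 1 - {0})) (restrict_space borel (sphere 0 1)) sgn)"

text \<open>\<open>d\<mu>(r\<zeta>) = r\<^sup>2\<^sup>a\<^sup>-\<^sup>1 dr Q(\<zeta>) d\<omega>(\<zeta>)\<close>. If the outer integrand is only
  Lebesgue measurable, the outer integral is a lower integral and still has the intended value.\<close>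

definition has_polar_decomposition ::
    "(real ^ 'd) measure \<Rightarrow> real \<Rightarrow> (real ^ 'd \<Rightarrow> real) \<Rightarrow> bool" where
  "has_polar_decomposition \<mu> a Q \<longleftrightarrow>
     (\<forall>A\<in>sets \<mu>. emeasure \<mu> A =
        (\<integral>\<^sup>+\<zeta>. (\<integral>\<^sup>+r\<in>{0<..}. ennreal (r powr (2 * a - 1)) * indicator A (r *\<^sub>R \<zeta>) \<partial>lborel)
               * ennreal (Q \<zeta>) \<partial>sphere_measure))"

section \<open>Square-integrable functions\<close>

text \<open>Elements of \<open>L\<^sup>2(\<mu>)\<close> are represented by functions; equality of elements is equality
  almost everywhere with respect to \<open>\<mu>\<close>.\<close>

definition L2 :: "'a measure \<Rightarrow> ('a \<Rightarrow> complex) set" where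
  "L2 \<mu> = {f \<in> borel_measurable \<mu>. integrable \<mu> (\<lambda>x. (cmod (f x))\<^sup>2)}"

definition L2_inner :: "'a measure \<Rightarrow> ('a \<Rightarrow> complex) \<Rightarrow> ('a \<Rightarrow> complex) \<Rightarrow> complex" where
  "L2_inner \<mu> f g = (\<integral>x. f x * cnj (g x) \<partial>\<mu>)"

definition L2_norm :: "'a measure \<Rightarrow> ('a \<Rightarrow> complex) \<Rightarrow> real" where
  "L2_norm \<mu> f = sqrt (\<integral>x. (cmod (f x))\<^sup>2 \<partial>\<mu>)"

definition unitary_on_L2 ::
    "'a measure \<Rightarrow> (('a \<Rightarrow> complex) \<Rightarrow> 'a \<Rightarrow> complex) \<Rightarrow> bool" where
  "unitary_on_L2 \<mu> U \<longleftrightarrow>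
     (\<forall>f\<in>L2 \<mu>. U f \<in> L2 \<mu>) \<and>
     (\<forall>f\<in>L2 \<mu>. \<forall>g\<in>L2 \<mu>. (AE x in \<mu>. f x = g x) \<longrightarrow> (AE x in \<mu>. U f x = U g x)) \<and>
     (\<forall>f\<in>L2 \<mu>. \<forall>g\<in>L2 \<mu>. AE x in \<mu>. U (\<lambda>y. f y + g y) x = U f x + U g x) \<and>
     (\<forall>c. \<forall>f\<in>L2 \<mu>. AE x in \<mu>. U (\<lambda>y. c * f y) x = c * U f x) \<and>
     (\<forall>f\<in>L2 \<mu>. \<forall>g\<in>L2 \<mu>. L2_inner \<mu> (U f) (U g) = L2_inner \<mu> f g) \<and>
     (\<forall>g\<in>L2 \<mu>. \<exists>f\<in>L2 \<mu>. AE x in \<mu>. U f x = g x)"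

definition L2_inv ::
    "'a measure \<Rightarrow> (('a \<Rightarrow> complex) \<Rightarrow> 'a \<Rightarrow> complex) \<Rightarrow> ('a \<Rightarrow> complex) \<Rightarrow> 'a \<Rightarrow> complex" where
  "L2_inv \<mu> U g = (SOME f. f \<in> L2 \<mu> \<and> (AE x in \<mu>. U f x = g x))"

definition L2_kernel ::
    "'a measure \<Rightarrow> (('a \<Rightarrow> complex) \<Rightarrow> 'a \<Rightarrow> complex) \<Rightarrow> ('a \<Rightarrow> complex) set" where
  "L2_kernel \<mu> L = {f \<in> L2 \<mu>. AE x in \<mu>. L f x = 0}"

definition L2_proj ::
    "'a measure \<Rightarrow> ('a \<Rightarrow> complex) set \<Rightarrow> ('a \<Rightarrow> complex) \<Rightarrow> 'a \<Rightarrow> complex" where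
  "L2_proj \<mu> V f = (SOME p. p \<in> V \<and> (\<forall>g\<in>V. L2_inner \<mu> (\<lambda>x. f x - p x) g = 0))"

section \<open>Schwartz functions\<close>

definition partial_deriv :: "'d \<Rightarrow> (real ^ 'd \<Rightarrow> complex) \<Rightarrow> real ^ 'd \<Rightarrow> complex" where
  "partial_deriv i f x = frechet_derivative f (at x) (axis i 1)"

definition schwartz :: "(real ^ 'd \<Rightarrow> complex) \<Rightarrow> bool" where
  "schwartz f \<longleftrightarrow>
     (\<forall>is. foldr partial_deriv is f differentiable_on UNIV \<and>
           (\<forall>k::nat. bounded (range (\<lambda>x. norm x ^ k * cmod (foldr partial_deriv is f x)))))"

definition schwartz_on :: "(real ^ 'd) set \<Rightarrow> (real ^ 'd \<Rightarrow> complex) \<Rightarrow> bool" where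
  "schwartz_on \<Omega> f \<longleftrightarrow> (\<exists>g. schwartz g \<and> (\<forall>x\<in>\<Omega>. f x = g x))"

section \<open>The integral transform\<close>

definition transform ::
    "'a measure \<Rightarrow> ('a \<Rightarrow> 'a \<Rightarrow> complex) \<Rightarrow> ('a \<Rightarrow> complex) \<Rightarrow> 'a \<Rightarrow> complex" where
  "transform \<mu> K f \<xi> = (\<integral>x. f x * K x \<xi> \<partial>\<mu>)"

text \<open>\<open>\<T>\<close> is the extension of the transform to \<open>L\<^sup>2(\<mu>)\<close>; it is unique
  almost everywhere, \<open>L\<^sup>1 \<inter> L\<^sup>2\<close> being dense in \<open>L\<^sup>2\<close>. The set \<open>\<Omega>\<close> need not be Borel, so
  \<open>\<mu>\<close> lives on its relative Borel sigma-algebra, and absolute continuity refers to \<open>lebesgue\<close>,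
  in which every set of this sigma-algebra is measurable because \<open>\<Omega>\<close> is convex.
  In \<open>inversion\<close>, continuity of \<open>f\<close> as an element of \<open>L\<^sup>1(\<mu>)\<close> means that \<open>f\<close> has a
  continuous representative.\<close>

locale integral_transform =
  fixes \<Omega> :: "(real ^ 'd) set"
    and \<mu> :: "(real ^ 'd) measure"
    and a :: real
    and Q :: "real ^ 'd \<Rightarrow> real"
    and K :: "real ^ 'd \<Rightarrow> real ^ 'd \<Rightarrow> complex"
    and cK :: real
    and \<T> :: "(real ^ 'd \<Rightarrow> complex) \<Rightarrow> real ^ 'd \<Rightarrow> complex"
  assumes convex: "convex \<Omega>"
    and cone: "\<And>x r. x \<in> \<Omega> \<Longrightarrow> r > 0 \<Longrightarrow> r *\<^sub>R x \<in> \<Omega>"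
    and interior: "interior \<Omega> \<noteq> {}"
    and sets_mu: "sets \<mu> = sets (restrict_space borel \<Omega>)"
    and abs_cont: "\<And>A. A \<in> sets \<mu> \<Longrightarrow> A \<in> null_sets lebesgue \<Longrightarrow> emeasure \<mu> A = 0"
    and a_pos: "a > 0"
    and Q_integrable: "integrable sphere_measure Q"
    and Q_nonneg: "AE \<zeta> in sphere_measure. Q \<zeta> \<ge> 0"
    and Q_nonzero: "\<not> (AE \<zeta> in sphere_measure. Q \<zeta> = 0)"
    and polar: "has_polar_decomposition \<mu> a Q"
    and K_continuous: "continuous_on (\<Omega> \<times> \<Omega>) (\<lambda>(x, \<xi>). K x \<xi>)"
    and K_bounded: "\<And>x \<xi>. x \<in> \<Omega> \<Longrightarrow> \<xi> \<in> \<Omega> \<Longrightarrow> cmod (K x \<xi>) \<le> cK"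
    and K_homogeneous:
      "\<And>x \<xi> r. x \<in> \<Omega> \<Longrightarrow> \<xi> \<in> \<Omega> \<Longrightarrow> r > 0 \<Longrightarrow> K (r *\<^sub>R x) \<xi> = K x (r *\<^sub>R \<xi>)"
    and inversion:
      "\<And>f. integrable \<mu> f \<Longrightarrow> integrable \<mu> (transform \<mu> K f) \<Longrightarrow>
         (\<exists>g. continuous_on \<Omega> g \<and> (AE x in \<mu>. f x = g x)) \<and>
         (AE x in \<mu>. f x = (\<integral>\<xi>. transform \<mu> K f \<xi> * cnj (K x \<xi>) \<partial>\<mu>))"
    and parseval:
      "\<And>f g. schwartz_on \<Omega> f \<Longrightarrow> schwartz_on \<Omega> g \<Longrightarrow>
         L2_inner \<mu> (transform \<mu> K f) (transform \<mu> K g) = L2_inner \<mu> f g"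
    and unitary: "unitary_on_L2 \<mu> \<T>"
    and extends:
      "\<And>f. integrable \<mu> f \<Longrightarrow> f \<in> L2 \<mu> \<Longrightarrow> AE \<xi> in \<mu>. \<T> f \<xi> = transform \<mu> K f \<xi>"
    and inverse_formula:
      "\<And>f. f \<in> L2 \<mu> \<Longrightarrow> AE x in \<mu>. L2_inv \<mu> \<T> f x = cnj (\<T> (\<lambda>y. cnj (f y)) x)"

section \<open>Phase space restriction\<close>

definition E_op :: "'a set \<Rightarrow> ('a \<Rightarrow> complex) \<Rightarrow> 'a \<Rightarrow> complex" where
  "E_op A f x = indicator A x * f x"

definition F_op :: "'a measure \<Rightarrow> (('a \<Rightarrow> complex) \<Rightarrow> 'a \<Rightarrow> complex) \<Rightarrow> 'a set \<Rightarrow>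
    ('a \<Rightarrow> complex) \<Rightarrow> 'a \<Rightarrow> complex" where
  "F_op \<mu> \<T> A f = L2_inv \<mu> \<T> (E_op A (\<T> f))"

definition L_op :: "'a measure \<Rightarrow> (('a \<Rightarrow> complex) \<Rightarrow> 'a \<Rightarrow> complex) \<Rightarrow> 'a set \<Rightarrow> 'a set \<Rightarrow>
    ('a \<Rightarrow> complex) \<Rightarrow> 'a \<Rightarrow> complex" where
  "L_op \<mu> \<T> S \<Sigma> f = E_op S (F_op \<mu> \<T> \<Sigma> (E_op S f))"

text \<open>The inner product below is real, \<open>L_op\<close> being self-adjoint.\<close>

definition L2_conc :: "'a measure \<Rightarrow> (('a \<Rightarrow> complex) \<Rightarrow> 'a \<Rightarrow> complex) \<Rightarrow> real \<Rightarrow>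
    'a set \<Rightarrow> 'a set \<Rightarrow> ('a \<Rightarrow> complex) set" where
  "L2_conc \<mu> \<T> \<epsilon> S \<Sigma> =
     {f \<in> L2 \<mu>. Re (L2_inner \<mu> (\<lambda>x. f x - L_op \<mu> \<T> S \<Sigma> f x) f) \<le> \<epsilon> * (L2_norm \<mu> f)\<^sup>2}"

section \<open>Spectral decomposition\<close>

text \<open>The positive eigenvalues are numbered from \<open>1\<close>; their number \<open>N\<close> is finite or infinite.\<close>

definition eig_index :: "enat \<Rightarrow> nat set" where
  "eig_index N = {n. 1 \<le> n \<and> enat n \<le> N}"

text \<open>The last conjunct is the expansion \<open>L f = \<Sum>\<^sub>n ev n \<cdot> \<langle>f, \<phi> n\<rangle> \<cdot> \<phi> n\<close>, convergent in
  \<open>L\<^sup>2(\<mu>)\<close>. It implies that every positive eigenvalue of \<open>L\<close> is listed as often as its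
  multiplicity.\<close>

definition spectral_decomposition ::
    "'a measure \<Rightarrow> (('a \<Rightarrow> complex) \<Rightarrow> 'a \<Rightarrow> complex) \<Rightarrow> enat \<Rightarrow> (nat \<Rightarrow> real) \<Rightarrow>
      (nat \<Rightarrow> 'a \<Rightarrow> complex) \<Rightarrow> bool" where
  "spectral_decomposition \<mu> L N ev \<phi> \<longleftrightarrow>
     (\<forall>n\<in>eig_index N. ev n > 0) \<and>
     (\<forall>m\<in>eig_index N. \<forall>n\<in>eig_index N. m \<le> n \<longrightarrow> ev n \<le> ev m) \<and>
     (\<forall>n\<in>eig_index N. \<phi> n \<in> L2 \<mu> \<and> (AE x in \<mu>. L (\<phi> n) x = of_real (ev n) * \<phi> n x)) \<and>
     (\<forall>m\<in>eig_index N. \<forall>n\<in>eig_index N. L2_inner \<mu> (\<phi> m) (\<phi> n) = (if m = n then 1 else 0)) \<and>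
     (\<forall>f\<in>L2 \<mu>.
        (\<lambda>k. L2_norm \<mu> (\<lambda>x. L f x -
           (\<Sum>n\<in>eig_index N \<inter> {..k}. of_real (ev n) * L2_inner \<mu> f (\<phi> n) * \<phi> n x)))
        \<longlonglongrightarrow> 0)"

definition eig_count :: "enat \<Rightarrow> (nat \<Rightarrow> real) \<Rightarrow> real \<Rightarrow> nat" where
  "eig_count N ev \<epsilon> = card {n \<in> eig_index N. ev n \<ge> 1 - \<epsilon>}"

end

theory Submission
  imports Defs
begin

text \<open>Every \<open>f\<close> splits orthogonally as \<open>f = f\<^sub>k\<^sub>e\<^sub>r + \<Sum>\<^sub>n \<langle>f, \<phi>\<^sub>n\<rangle> \<phi>\<^sub>n\<close>, so
  \<open>\<langle>f - L f, f\<rangle> = \<parallel>f\<^sub>k\<^sub>e\<^sub>r\<parallel>\<^sup>2 + \<Sum>\<^sub>n (1 - \<lambda>\<^sub>n) |\<langle>f, \<phi>\<^sub>n\<rangle>|\<^sup>2\<close>, and comparing this with \<open>\<epsilon> \<parallel>f\<parallel>\<^sup>2\<close> term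
  by term gives the equivalence. For the approximation estimate, the squared error is
  \<open>\<parallel>f\<^sub>k\<^sub>e\<^sub>r\<parallel>\<^sup>2\<close> plus the \<open>|\<langle>f, \<phi>\<^sub>n\<rangle>|\<^sup>2\<close> with \<open>1 - \<lambda>\<^sub>n > \<epsilon>\<^sub>0\<close>, hence at most \<open>\<langle>f - L f, f\<rangle> / \<epsilon>\<^sub>0\<close>.
  The projection \<open>f\<^sub>k\<^sub>e\<^sub>r\<close> exists by the Riesz--Fischer theorem, and orthogonality of the \<open>\<phi>\<^sub>n\<close> to the
  kernel follows from the expansion of \<open>L\<close> alone, without its self-adjointness.\<close>

section \<open>Square-integrable functions\<close>

lemma borel_measurable_cnj [measurable (raw)]:
  "f \<in> borel_measurable M \<Longrightarrow> (\<lambda>x. cnj (f x)) \<in> borel_measurable M"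
  by (rule measurable_compose[OF _ borel_measurable_continuous_onI])
     (auto intro: continuous_intros)

lemma L2_measurable [measurable_dest]: "f \<in> L2 \<mu> \<Longrightarrow> f \<in> borel_measurable \<mu>"
  by (simp add: L2_def)

lemma L2_integrable_power2: "f \<in> L2 \<mu> \<Longrightarrow> integrable \<mu> (\<lambda>x. (cmod (f x))\<^sup>2)"
  by (simp add: L2_def)

lemma L2_scale: "f \<in> L2 \<mu> \<Longrightarrow> (\<lambda>x. c * f x) \<in> L2 \<mu>"
  by (auto simp: L2_def norm_mult power_mult_distrib)

lemma cmod_add_power2_le: "(cmod (u + v))\<^sup>2 \<le> 2 * (cmod u)\<^sup>2 + 2 * (cmod v)\<^sup>2"
proof -
  have "(cmod (u + v))\<^sup>2 \<le> (cmod u + cmod v)\<^sup>2"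
    by (simp add: norm_triangle_ineq power_mono)
  also have "\<dots> \<le> 2 * (cmod u)\<^sup>2 + 2 * (cmod v)\<^sup>2"
    using sum_squares_bound[of "cmod u" "cmod v"] by (simp add: power2_sum)
  finally show ?thesis .
qed

lemma L2_add:
  assumes f: "f \<in> L2 \<mu>" and g: "g \<in> L2 \<mu>"
  shows "(\<lambda>x. f x + g x) \<in> L2 \<mu>"
proof -
  note [measurable] = f g
  have "integrable \<mu> (\<lambda>x. (cmod (f x + g x))\<^sup>2)"
    by (rule Bochner_Integration.integrable_bound
          [where f = "\<lambda>x. 2 * (cmod (f x))\<^sup>2 + 2 * (cmod (g x))\<^sup>2"])
       (use f g in \<open>auto simp: L2_integrable_power2 cmod_add_power2_le\<close>)
  then show ?thesis by (simp add: L2_def)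
qed

lemma L2_diff: "f \<in> L2 \<mu> \<Longrightarrow> g \<in> L2 \<mu> \<Longrightarrow> (\<lambda>x. f x - g x) \<in> L2 \<mu>"
  using L2_add[of f \<mu> "\<lambda>x. (-1) * g x"] L2_scale[of g \<mu> "-1"] by simp

lemma L2_zero: "(\<lambda>x. 0) \<in> L2 \<mu>"
  by (simp add: L2_def)

lemma L2_sum: "(\<And>i. i \<in> F \<Longrightarrow> g i \<in> L2 \<mu>) \<Longrightarrow> (\<lambda>x. \<Sum>i\<in>F. g i x) \<in> L2 \<mu>"
  by (induction F rule: infinite_finite_induct) (auto simp: L2_zero L2_add)

section \<open>Inner product and norm\<close>

lemma L2_mult_integrable:
  assumes f: "f \<in> L2 \<mu>" and g: "g \<in> L2 \<mu>"
  shows "integrable \<mu> (\<lambda>x. f x * cnj (g x))"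
proof -
  note [measurable] = f g
  have "cmod u * cmod v \<le> (cmod u)\<^sup>2 + (cmod v)\<^sup>2" for u v
    using sum_squares_bound[of "cmod u" "cmod v"] mult_nonneg_nonneg[OF norm_ge_zero norm_ge_zero, of u v]
    by linarith
  then show ?thesis
    by - (rule Bochner_Integration.integrable_bound
          [where f = "\<lambda>x. (cmod (f x))\<^sup>2 + (cmod (g x))\<^sup>2"],
        use f g in \<open>auto simp: L2_integrable_power2 norm_mult\<close>)
qed

lemma L2_inner_add_left:
  assumes "f \<in> L2 \<mu>" "g \<in> L2 \<mu>" "h \<in> L2 \<mu>"
  shows "L2_inner \<mu> (\<lambda>x. f x + g x) h = L2_inner \<mu> f h + L2_inner \<mu> g h"
  unfolding L2_inner_def by (simp add: distrib_right L2_mult_integrable assms)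

lemma L2_inner_diff_left:
  assumes "f \<in> L2 \<mu>" "g \<in> L2 \<mu>" "h \<in> L2 \<mu>"
  shows "L2_inner \<mu> (\<lambda>x. f x - g x) h = L2_inner \<mu> f h - L2_inner \<mu> g h"
  unfolding L2_inner_def by (simp add: left_diff_distrib L2_mult_integrable assms)

lemma L2_inner_scale_left: "L2_inner \<mu> (\<lambda>x. c * f x) h = c * L2_inner \<mu> f h"
  unfolding L2_inner_def by (simp add: mult.assoc)

lemma L2_inner_sum_left:
  assumes "\<And>i. i \<in> F \<Longrightarrow> g i \<in> L2 \<mu>" "h \<in> L2 \<mu>"
  shows "L2_inner \<mu> (\<lambda>x. \<Sum>i\<in>F. g i x) h = (\<Sum>i\<in>F. L2_inner \<mu> (g i) h)"
  using assms(1)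
proof (induction F rule: infinite_finite_induct)
  case (insert i F)
  then show ?case
    by (simp add: L2_inner_add_left L2_sum assms(2))
qed (simp_all add: L2_inner_def)

lemma L2_inner_commute: "L2_inner \<mu> g f = cnj (L2_inner \<mu> f g)"
  by (simp add: L2_inner_def mult.commute flip: Bochner_Integration.integral_cnj)

lemma L2_inner_diff_right:
  assumes "f \<in> L2 \<mu>" "g \<in> L2 \<mu>" "h \<in> L2 \<mu>"
  shows "L2_inner \<mu> h (\<lambda>x. f x - g x) = L2_inner \<mu> h f - L2_inner \<mu> h g"
  unfolding L2_inner_commute[of \<mu> h] by (simp add: L2_inner_diff_left assms)

lemma L2_inner_scale_right: "L2_inner \<mu> h (\<lambda>x. c * f x) = cnj c * L2_inner \<mu> h f"
  unfolding L2_inner_commute[of \<mu> h] by (simp add: L2_inner_scale_left)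

lemma L2_norm_nonneg [simp]: "0 \<le> L2_norm \<mu> f"
  by (simp add: L2_norm_def)

lemma L2_norm_power2: "(L2_norm \<mu> f)\<^sup>2 = (\<integral>x. (cmod (f x))\<^sup>2 \<partial>\<mu>)"
  by (simp add: L2_norm_def)

lemma L2_inner_self: "L2_inner \<mu> f f = of_real ((L2_norm \<mu> f)\<^sup>2)"
  unfolding L2_inner_def L2_norm_power2 complex_norm_square[symmetric] integral_complex_of_real ..

lemma L2_inner_cong_AE:
  assumes "f \<in> L2 \<mu>" "g \<in> L2 \<mu>" "h \<in> L2 \<mu>" "AE x in \<mu>. f x = g x"
  shows "L2_inner \<mu> f h = L2_inner \<mu> g h"
proof -
  note [measurable] = L2_measurable[OF assms(1)] L2_measurable[OF assms(2)] L2_measurable[OF assms(3)]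
  show ?thesis
    unfolding L2_inner_def by (rule integral_cong_AE) (use assms(4) in auto)
qed

lemma L2_norm_eq_0_iff:
  assumes "f \<in> L2 \<mu>"
  shows "L2_norm \<mu> f = 0 \<longleftrightarrow> (AE x in \<mu>. f x = 0)"
  using integral_nonneg_eq_0_iff_AE[OF L2_integrable_power2[OF assms]]
  by (simp add: L2_norm_def)

lemma L2_norm_diff_power2:
  assumes f: "f \<in> L2 \<mu>" and g: "g \<in> L2 \<mu>"
  shows "(L2_norm \<mu> (\<lambda>x. f x - g x))\<^sup>2
    = (L2_norm \<mu> f)\<^sup>2 - 2 * Re (L2_inner \<mu> f g) + (L2_norm \<mu> g)\<^sup>2"
proof -
  have "L2_inner \<mu> (\<lambda>x. f x - g x) (\<lambda>x. f x - g x)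
      = (L2_inner \<mu> f f - L2_inner \<mu> g f) - (L2_inner \<mu> f g - L2_inner \<mu> g g)"
    by (simp add: L2_inner_diff_left L2_inner_diff_right L2_diff f g)
  then have "Re (L2_inner \<mu> (\<lambda>x. f x - g x) (\<lambda>x. f x - g x))
      = Re (L2_inner \<mu> f f) - Re (L2_inner \<mu> g f) - Re (L2_inner \<mu> f g) + Re (L2_inner \<mu> g g)"
    by simp
  moreover have "Re (L2_inner \<mu> g f) = Re (L2_inner \<mu> f g)"
    by (subst L2_inner_commute) simp
  ultimately show ?thesis
    unfolding L2_inner_self by simp
qed

text \<open>Subtract from f its projection onto g and expand the squared norm, which is nonnegative.
  The projection divides by the squared norm of g, so a function g that vanishes almost everywhere
  is treated first.\<close>

lemma L2_Cauchy_Schwarz: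
  assumes f: "f \<in> L2 \<mu>" and g: "g \<in> L2 \<mu>"
  shows "cmod (L2_inner \<mu> f g) \<le> L2_norm \<mu> f * L2_norm \<mu> g"
proof (cases "L2_norm \<mu> g = 0")
  case True
  then have "AE x in \<mu>. g x = 0"
    using L2_norm_eq_0_iff g by blast
  then have "L2_inner \<mu> g f = L2_inner \<mu> (\<lambda>x. 0) f"
    using L2_inner_cong_AE[OF g L2_zero f] by simp
  then have "L2_inner \<mu> f g = 0"
    by (subst L2_inner_commute) (simp add: L2_inner_def)
  then show ?thesis by simp
next
  case False
  define B where "B = (L2_norm \<mu> g)\<^sup>2"
  define c where "c = L2_inner \<mu> f g"
  have B: "B > 0" using False by (simp add: B_def)
  have "L2_inner \<mu> f (\<lambda>x. c / of_real B * g x) = cnj (c / of_real B) * c"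
    by (simp only: L2_inner_scale_right c_def)
  also have "\<dots> = (c * cnj c) / of_real B"
    by simp
  also have "\<dots> = of_real ((cmod c)\<^sup>2 / B)"
    by (simp only: complex_norm_square[symmetric] of_real_divide)
  finally have 1: "Re (L2_inner \<mu> f (\<lambda>x. c / of_real B * g x)) = (cmod c)\<^sup>2 / B"
    by (simp only: Re_complex_of_real)
  have 2: "(L2_norm \<mu> (\<lambda>x. c / of_real B * g x))\<^sup>2 = (cmod c)\<^sup>2 / B"
    using B unfolding L2_norm_power2
    by (simp add: norm_mult norm_divide power_mult_distrib power_divide
        L2_norm_power2[symmetric] B_def[symmetric]) (simp add: power2_eq_square)
  have "0 \<le> (L2_norm \<mu> f)\<^sup>2 - (cmod c)\<^sup>2 / B"
    using L2_norm_diff_power2[OF f L2_scale[OF g, of "c / of_real B"]] 1 2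
      zero_le_power2[of "L2_norm \<mu> (\<lambda>x. f x - c / of_real B * g x)"] by linarith
  then have "(cmod c)\<^sup>2 \<le> (L2_norm \<mu> f * L2_norm \<mu> g)\<^sup>2"
    using B by (simp add: field_simps B_def power_mult_distrib)
  then show ?thesis
    unfolding c_def by (rule power2_le_imp_le) simp
qed

text \<open>Cauchy-Schwarz makes the pairing with a fixed h continuous. Through this, expansions
  that converge in the L2 norm become limits of complex numbers.\<close>

lemma tendsto_L2_inner:
  assumes s: "\<And>k. s k \<in> L2 \<mu>" and g: "g \<in> L2 \<mu>" and h: "h \<in> L2 \<mu>"
    and lim: "(\<lambda>k. L2_norm \<mu> (\<lambda>x. g x - s k x)) \<longlonglongrightarrow> 0"
  shows "(\<lambda>k. L2_inner \<mu> (s k) h) \<longlonglongrightarrow> L2_inner \<mu> g h"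
proof -
  have "(\<lambda>k. L2_norm \<mu> (\<lambda>x. g x - s k x) * L2_norm \<mu> h) \<longlonglongrightarrow> 0"
    using tendsto_mult_right[OF lim, of "L2_norm \<mu> h"] by simp
  then have "(\<lambda>k. L2_inner \<mu> g h - L2_inner \<mu> (s k) h) \<longlonglongrightarrow> 0"
    by (rule Lim_null_comparison[rotated])
       (simp add: L2_inner_diff_left[symmetric] L2_Cauchy_Schwarz L2_diff s g h)
  then have "(\<lambda>k. L2_inner \<mu> g h - (L2_inner \<mu> g h - L2_inner \<mu> (s k) h)) \<longlonglongrightarrow> L2_inner \<mu> g h - 0"
    by (intro tendsto_diff tendsto_const)
  then show ?thesis by simp
qed

section \<open>Completeness\<close>

lemma nn_integral_L2_norm:
  assumes "f \<in> L2 \<mu>"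
  shows "(\<integral>\<^sup>+x. ennreal ((cmod (f x))\<^sup>2) \<partial>\<mu>) = ennreal ((L2_norm \<mu> f)\<^sup>2)"
  unfolding L2_norm_power2
  by (rule nn_integral_eq_integral) (use assms in \<open>auto simp: L2_integrable_power2\<close>)

text \<open>Finiteness of \<open>\<Sum>\<^sub>j 2\<^sup>j \<parallel>s\<^sub>j\<^sub>+\<^sub>1 - s\<^sub>j\<parallel>\<^sup>2\<close> makes \<open>\<Sum>\<^sub>j 2\<^sup>j |s\<^sub>j\<^sub>+\<^sub>1(x) - s\<^sub>j(x)|\<^sup>2\<close> finite for almost
  every \<open>x\<close>, so the increments decay geometrically there.\<close>

lemma AE_convergent_if_rapidly_Cauchy:
  assumes s: "\<And>j. s j \<in> L2 \<mu>"
    and rapid: "\<And>j. (L2_norm \<mu> (\<lambda>x. s (Suc j) x - s j x))\<^sup>2 \<le> (1/4) ^ j"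
  shows "AE x in \<mu>. convergent (\<lambda>j. s j x)"
proof -
  note [measurable] = L2_measurable[OF s]
  have "(\<integral>\<^sup>+x. (\<Sum>j. ennreal (2 ^ j * (cmod (s (Suc j) x - s j x))\<^sup>2)) \<partial>\<mu>)
      = (\<Sum>j. \<integral>\<^sup>+x. ennreal (2 ^ j * (cmod (s (Suc j) x - s j x))\<^sup>2) \<partial>\<mu>)"
    by (rule nn_integral_suminf) measurable
  also have "\<dots> \<le> (\<Sum>j. ennreal ((1/2) ^ j))"
  proof (intro suminf_le summableI)
    fix j
    have "(\<integral>\<^sup>+x. ennreal (2 ^ j * (cmod (s (Suc j) x - s j x))\<^sup>2) \<partial>\<mu>)
        = ennreal (2 ^ j) * ennreal ((L2_norm \<mu> (\<lambda>x. s (Suc j) x - s j x))\<^sup>2)"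
      by (simp add: ennreal_mult nn_integral_cmult nn_integral_L2_norm L2_diff s)
    also have "\<dots> \<le> ennreal (2 ^ j * (1/4) ^ j)"
      by (subst ennreal_mult[symmetric]) (auto intro!: ennreal_leI mult_left_mono rapid)
    \<comment> \<open>The weight \<open>2 ^ j\<close> uses up only part of the decay 1/4: the
      integrals still sum as a geometric series, and what the weight contributes becomes pointwise
      decay of the increments below.\<close>
    also have "2 ^ j * (1/4) ^ j = (1/2 :: real) ^ j"
      by (simp flip: power_mult_distrib)
    finally show "(\<integral>\<^sup>+x. ennreal (2 ^ j * (cmod (s (Suc j) x - s j x))\<^sup>2) \<partial>\<mu>) \<le> ennreal ((1/2) ^ j)" .
  qed
  also have "\<dots> < \<infinity>"
    by (subst suminf_ennreal_eq[OF _ geometric_sums]) auto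
  finally have "AE x in \<mu>. (\<Sum>j. ennreal (2 ^ j * (cmod (s (Suc j) x - s j x))\<^sup>2)) \<noteq> \<infinity>"
    by (intro nn_integral_PInf_AE) auto
  then show ?thesis
  proof (rule AE_mp, intro AE_I2 impI)
    fix x assume "(\<Sum>j. ennreal (2 ^ j * (cmod (s (Suc j) x - s j x))\<^sup>2)) \<noteq> \<infinity>"
    then have "summable (\<lambda>j. 2 ^ j * (cmod (s (Suc j) x - s j x))\<^sup>2)"
      by (intro summable_suminf_not_top) auto
    then have "(\<lambda>j. 2 ^ j * (cmod (s (Suc j) x - s j x))\<^sup>2) \<longlonglongrightarrow> 0"
      by (rule summable_LIMSEQ_zero)
    then have "\<forall>\<^sub>F j in sequentially. 2 ^ j * (cmod (s (Suc j) x - s j x))\<^sup>2 < 1"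
      by (rule order_tendstoD) simp
    then have "\<forall>\<^sub>F j in sequentially. norm (s (Suc j) x - s j x) \<le> (1 / sqrt 2) ^ j"
    proof eventually_elim
      case (elim j)
      then have "(cmod (s (Suc j) x - s j x))\<^sup>2 \<le> (1/2) ^ j"
        by (simp add: field_simps power_divide)
      also have "(1/2) ^ j = ((1 / sqrt 2) ^ j)\<^sup>2"
        by (simp add: power_divide flip: power_mult power_mult_distrib)
           (simp add: power_mult mult.commute[of j])
      finally show ?case
        by (rule power2_le_imp_le) simp
    qed
    then have "summable (\<lambda>j. s (Suc j) x - s j x)"
      by (rule summable_comparison_test_ev) (auto intro!: summable_geometric simp: real_less_rsqrt)
    then have "convergent (\<lambda>n. \<Sum>j<n. s (Suc j) x - s j x)"
      by (simp add: summable_iff_convergent)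
    then have "convergent (\<lambda>n. s n x - s 0 x)"
      by (simp only: sum_lessThan_telescope[of "\<lambda>j. s j x"])
    then show "convergent (\<lambda>j. s j x)"
      by (simp only: convergent_diff_const_right_iff)
  qed
qed

text \<open>A rapidly Cauchy subsequence converges almost everywhere. Fatou's lemma along this
  subsequence then transfers the Cauchy estimate to the distance between \<open>s k\<close> and the
  pointwise limit.\<close>

theorem L2_complete:
  assumes s: "\<And>k. s k \<in> L2 \<mu>"
    and Cauchy: "\<And>e. e > 0 \<Longrightarrow> \<exists>M. \<forall>m\<ge>M. \<forall>n\<ge>M. (L2_norm \<mu> (\<lambda>x. s m x - s n x))\<^sup>2 < e"
  obtains g where "g \<in> L2 \<mu>" "(\<lambda>k. L2_norm \<mu> (\<lambda>x. g x - s k x)) \<longlonglongrightarrow> 0"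
proof -
  note [measurable] = L2_measurable[OF s]
  obtain M where M: "\<And>j m n. m \<ge> M j \<Longrightarrow> n \<ge> M j \<Longrightarrow>
      (L2_norm \<mu> (\<lambda>x. s m x - s n x))\<^sup>2 < (1/4 :: real) ^ j"
    using Cauchy[of "(1/4) ^ j" for j] by (simp, metis)
  \<comment> \<open>Summing the thresholds makes both \<open>r j\<close> and
    \<open>r (Suc j)\<close> exceed \<open>M j\<close>, so consecutive terms of the subsequence
    satisfy the bound for j. The extra summand j forces \<open>r j\<close> to tend to
    infinity.\<close>
  define r where "r j = (\<Sum>i\<le>j. M i) + j" for j
  have rM: "M j \<le> r j" for j
    unfolding r_def by (intro trans_le_add1 member_le_sum) auto
  have rj: "j \<le> r j" for j by (simp add: r_def)
  have rSuc: "M j \<le> r (Suc j)" for j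
    using rM[of j] by (simp add: r_def)
  \<comment> \<open>Where the subsequence diverges, \<open>lim\<close> has an unspecified value;
    this happens only on a null set, and g is measurable all the same.\<close>
  define g where "g x = lim (\<lambda>j. s (r j) x)" for x
  have [measurable]: "g \<in> borel_measurable \<mu>"
    unfolding g_def by measurable
  have "AE x in \<mu>. convergent (\<lambda>j. s (r j) x)"
    by (rule AE_convergent_if_rapidly_Cauchy[OF s]) (auto intro!: less_imp_le M rM rSuc)
  then have g: "AE x in \<mu>. (\<lambda>j. s (r j) x) \<longlonglongrightarrow> g x"
    by (auto simp: g_def convergent_LIMSEQ_iff)
  have tail: "\<exists>M. \<forall>k\<ge>M. (\<integral>\<^sup>+x. ennreal ((cmod (g x - s k x))\<^sup>2) \<partial>\<mu>) \<le> ennreal e" if pos: "e > 0" for e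
  proof -
    obtain M where M: "\<And>m n. m \<ge> M \<Longrightarrow> n \<ge> M \<Longrightarrow> (L2_norm \<mu> (\<lambda>x. s m x - s n x))\<^sup>2 < e"
      using Cauchy[OF pos] by blast
    show ?thesis
    proof (intro exI allI impI)
      fix k assume k: "M \<le> k"
      have "(\<integral>\<^sup>+x. ennreal ((cmod (g x - s k x))\<^sup>2) \<partial>\<mu>)
          = (\<integral>\<^sup>+x. liminf (\<lambda>j. ennreal ((cmod (s (r j) x - s k x))\<^sup>2)) \<partial>\<mu>)"
      proof (rule nn_integral_cong_AE, use g in eventually_elim)
        case (elim x)
        have "(\<lambda>j. ennreal ((cmod (s (r j) x - s k x))\<^sup>2)) \<longlonglongrightarrow> ennreal ((cmod (g x - s k x))\<^sup>2)"
          by (intro tendsto_ennrealI tendsto_intros elim)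
        then show ?case
          by (intro lim_imp_Liminf[symmetric]) auto
      qed
      also have "\<dots> \<le> liminf (\<lambda>j. \<integral>\<^sup>+x. ennreal ((cmod (s (r j) x - s k x))\<^sup>2) \<partial>\<mu>)"
        by (rule nn_integral_liminf) measurable
      also have "\<dots> \<le> liminf (\<lambda>j. ennreal e)"
      proof (rule Liminf_mono, rule eventually_sequentiallyI)
        fix j assume "M \<le> j"
        then have "M \<le> r j" using rj le_trans by blast
        then show "(\<integral>\<^sup>+x. ennreal ((cmod (s (r j) x - s k x))\<^sup>2) \<partial>\<mu>) \<le> ennreal e"
          using M[OF _ k] by (simp add: nn_integral_L2_norm L2_diff s ennreal_leI less_imp_le)
      qed
      finally show "(\<integral>\<^sup>+x. ennreal ((cmod (g x - s k x))\<^sup>2) \<partial>\<mu>) \<le> ennreal e"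
        by (simp add: Liminf_const)
    qed
  qed
  have gL2: "g \<in> L2 \<mu>"
  proof -
    \<comment> \<open>One index with finite error is enough, since g is the sum of
      \<open>g - s k\<close> and \<open>s k\<close>.\<close>
    obtain k where "(\<integral>\<^sup>+x. ennreal ((cmod (g x - s k x))\<^sup>2) \<partial>\<mu>) \<le> ennreal 1"
      using tail[of 1] by auto
    then have "(\<integral>\<^sup>+x. ennreal ((cmod (g x - s k x))\<^sup>2) \<partial>\<mu>) < \<infinity>"
      using ennreal_less_top order.strict_trans1 by fastforce
    then have "(\<lambda>x. g x - s k x) \<in> L2 \<mu>"
      unfolding L2_def by (auto intro!: integrableI_nonneg)
    then show ?thesis
      using L2_add[OF _ s[of k]] by fastforce
  qed
  have "(\<lambda>k. (L2_norm \<mu> (\<lambda>x. g x - s k x))\<^sup>2) \<longlonglongrightarrow> 0"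
  proof (rule LIMSEQ_I)
    fix e :: real assume "e > 0"
    then obtain M where "\<forall>k\<ge>M. (L2_norm \<mu> (\<lambda>x. g x - s k x))\<^sup>2 \<le> e / 2"
      using tail[of "e / 2"] by (auto simp: nn_integral_L2_norm L2_diff s gL2 ennreal_le_iff)
    then show "\<exists>M. \<forall>k\<ge>M. norm ((L2_norm \<mu> (\<lambda>x. g x - s k x))\<^sup>2 - 0) < e"
      using \<open>e > 0\<close> by (intro exI[of _ M]) force
  qed
  then have "(\<lambda>k. sqrt ((L2_norm \<mu> (\<lambda>x. g x - s k x))\<^sup>2)) \<longlonglongrightarrow> sqrt 0"
    by (rule tendsto_real_sqrt)
  then show thesis
    using that[OF gL2] by simp
qed

section \<open>Orthonormal systems\<close>

definition L2_orthonormal :: "'a measure \<Rightarrow> 'i set \<Rightarrow> ('i \<Rightarrow> 'a \<Rightarrow> complex) \<Rightarrow> bool" where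
  "L2_orthonormal \<mu> I \<phi> \<longleftrightarrow>
     (\<forall>n\<in>I. \<phi> n \<in> L2 \<mu>) \<and>
     (\<forall>m\<in>I. \<forall>n\<in>I. L2_inner \<mu> (\<phi> m) (\<phi> n) = (if m = n then 1 else 0))"

lemma L2_orthonormal_L2: "L2_orthonormal \<mu> I \<phi> \<Longrightarrow> n \<in> I \<Longrightarrow> \<phi> n \<in> L2 \<mu>"
  by (simp add: L2_orthonormal_def)

lemma L2_orthonormal_span:
  assumes "L2_orthonormal \<mu> I \<phi>" "F \<subseteq> I"
  shows "(\<lambda>x. \<Sum>n\<in>F. c n * \<phi> n x) \<in> L2 \<mu>"
  by (intro L2_sum L2_scale L2_orthonormal_L2[OF assms(1)]) (use assms(2) in auto)

lemma L2_inner_orthonormal_span: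
  assumes "L2_orthonormal \<mu> I \<phi>" "F \<subseteq> I" "h \<in> L2 \<mu>"
  shows "L2_inner \<mu> (\<lambda>x. \<Sum>n\<in>F. c n * \<phi> n x) h = (\<Sum>n\<in>F. c n * cnj (L2_inner \<mu> h (\<phi> n)))"
proof -
  have "L2_inner \<mu> (\<lambda>x. \<Sum>n\<in>F. c n * \<phi> n x) h = (\<Sum>n\<in>F. c n * L2_inner \<mu> (\<phi> n) h)"
    by (subst L2_inner_sum_left)
       (use assms in \<open>auto simp: L2_inner_scale_left intro!: L2_scale L2_orthonormal_L2\<close>)
  then show ?thesis
    by (simp add: L2_inner_commute[of \<mu> h])
qed

lemma L2_inner_orthonormal_coeff:
  assumes on: "L2_orthonormal \<mu> I \<phi>" and F: "F \<subseteq> I" "finite F" and m: "m \<in> I"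
  shows "L2_inner \<mu> (\<lambda>x. \<Sum>n\<in>F. c n * \<phi> n x) (\<phi> m) = (if m \<in> F then c m else 0)"
proof -
  have "L2_inner \<mu> (\<lambda>x. \<Sum>n\<in>F. c n * \<phi> n x) (\<phi> m) = (\<Sum>n\<in>F. if n = m then c n else 0)"
    unfolding L2_inner_orthonormal_span[OF on F(1) L2_orthonormal_L2[OF on m]]
    by (rule sum.cong) (use on F(1) m in \<open>auto simp: L2_orthonormal_def\<close>)
  then show ?thesis
    using F(2) by simp
qed

lemma L2_norm_orthonormal_span:
  assumes on: "L2_orthonormal \<mu> I \<phi>" and F: "F \<subseteq> I" "finite F"
  shows "(L2_norm \<mu> (\<lambda>x. \<Sum>n\<in>F. c n * \<phi> n x))\<^sup>2 = (\<Sum>n\<in>F. (cmod (c n))\<^sup>2)"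
proof -
  let ?s = "\<lambda>x. \<Sum>n\<in>F. c n * \<phi> n x"
  have "complex_of_real ((L2_norm \<mu> ?s)\<^sup>2) = (\<Sum>n\<in>F. c n * cnj (L2_inner \<mu> ?s (\<phi> n)))"
    unfolding L2_inner_self[symmetric]
    by (rule L2_inner_orthonormal_span[OF on F(1) L2_orthonormal_span[OF on F(1)]])
  also have "\<dots> = (\<Sum>n\<in>F. of_real ((cmod (c n))\<^sup>2))"
    by (rule sum.cong)
       (use F in \<open>auto simp: L2_inner_orthonormal_coeff[OF on F] complex_norm_square simp del: of_real_power\<close>)
  finally show ?thesis
    unfolding of_real_sum[symmetric] of_real_eq_iff .
qed

text \<open>Pythagoras: the cross term and the squared norm of the partial sum both reduce to the
  sum of the squared coefficients. This gives Bessel's inequality and, later, the exact error of the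
  approximation by the leading eigenfunctions.\<close>

lemma L2_norm_diff_partial_sum:
  assumes on: "L2_orthonormal \<mu> I \<phi>" and F: "F \<subseteq> I" "finite F" and f: "f \<in> L2 \<mu>"
  shows "(L2_norm \<mu> (\<lambda>x. f x - (\<Sum>n\<in>F. L2_inner \<mu> f (\<phi> n) * \<phi> n x)))\<^sup>2
    = (L2_norm \<mu> f)\<^sup>2 - (\<Sum>n\<in>F. (cmod (L2_inner \<mu> f (\<phi> n)))\<^sup>2)"
proof -
  let ?s = "\<lambda>x. \<Sum>n\<in>F. L2_inner \<mu> f (\<phi> n) * \<phi> n x"
  have "L2_inner \<mu> ?s f = of_real (\<Sum>n\<in>F. (cmod (L2_inner \<mu> f (\<phi> n)))\<^sup>2)"
    unfolding L2_inner_orthonormal_span[OF on F(1) f] of_real_sum complex_norm_square ..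
  then have "Re (L2_inner \<mu> f ?s) = (\<Sum>n\<in>F. (cmod (L2_inner \<mu> f (\<phi> n)))\<^sup>2)"
    by (subst L2_inner_commute) simp
  then show ?thesis
    using L2_norm_diff_power2[OF f L2_orthonormal_span[OF on F(1)], of "\<lambda>n. L2_inner \<mu> f (\<phi> n)"]
      L2_norm_orthonormal_span[OF on F, of "\<lambda>n. L2_inner \<mu> f (\<phi> n)"] by simp
qed

lemma L2_Bessel:
  assumes "L2_orthonormal \<mu> I \<phi>" "F \<subseteq> I" "finite F" "f \<in> L2 \<mu>"
  shows "(\<Sum>n\<in>F. (cmod (L2_inner \<mu> f (\<phi> n)))\<^sup>2) \<le> (L2_norm \<mu> f)\<^sup>2"
proof -
  have "0 \<le> (L2_norm \<mu> f)\<^sup>2 - (\<Sum>n\<in>F. (cmod (L2_inner \<mu> f (\<phi> n)))\<^sup>2)"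
    unfolding L2_norm_diff_partial_sum[OF assms, symmetric] by (rule zero_le_power2)
  then show ?thesis by simp
qed

lemma L2_Bessel_summable:
  assumes "L2_orthonormal \<mu> I \<phi>" "f \<in> L2 \<mu>"
  shows "(\<lambda>n. (cmod (L2_inner \<mu> f (\<phi> n)))\<^sup>2) summable_on I"
proof (rule nonneg_bdd_above_summable_on)
  show "bdd_above (sum (\<lambda>n. (cmod (L2_inner \<mu> f (\<phi> n)))\<^sup>2) ` {F. F \<subseteq> I \<and> finite F})"
    by (rule bdd_aboveI2[of _ _ "(L2_norm \<mu> f)\<^sup>2"]) (use L2_Bessel assms in auto)
qed simp

text \<open>The initial segments of I are cofinal among its finite subsets. This links the unordered
  sums of the final statement with the ordered partial sums in
  \<open>spectral_decomposition\<close>.\<close>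

lemma summable_on_imp_LIMSEQ:
  fixes g :: "nat \<Rightarrow> 'a :: {comm_monoid_add, t2_space}"
  assumes "g summable_on I"
  shows "(\<lambda>k. sum g (I \<inter> {..k})) \<longlonglongrightarrow> infsum g I"
proof -
  have "filterlim (\<lambda>k. I \<inter> {..k}) (finite_subsets_at_top I) sequentially"
    unfolding filterlim_finite_subsets_at_top
  proof (intro allI impI)
    fix X assume X: "finite X \<and> X \<subseteq> I"
    then show "\<forall>\<^sub>F k in sequentially. finite (I \<inter> {..k}) \<and> X \<subseteq> I \<inter> {..k} \<and> I \<inter> {..k} \<subseteq> I"
      \<comment> \<open>Inserting 0 keeps \<open>Max\<close> meaningful when X is empty.\<close>
      by (intro eventually_sequentiallyI[of "Max (insert 0 X)"]) (force intro: order_trans[OF Max_ge])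
  qed
  then show ?thesis
    using filterlim_compose has_sum_infsum[OF assms] unfolding has_sum_def by blast
qed

text \<open>By orthonormality, the squared distance of two partial sums is the difference of the
  corresponding partial sums of the squared coefficients. The latter form a Cauchy sequence, so
  completeness applies.\<close>

lemma L2_Riesz_Fischer:
  fixes I :: "nat set"
  assumes on: "L2_orthonormal \<mu> I \<phi>" and c: "(\<lambda>n. (cmod (c n))\<^sup>2) summable_on I"
  obtains g where "g \<in> L2 \<mu>"
    "(\<lambda>k. L2_norm \<mu> (\<lambda>x. g x - (\<Sum>n\<in>I \<inter> {..k}. c n * \<phi> n x))) \<longlonglongrightarrow> 0"
proof (rule L2_complete)
  let ?s = "\<lambda>k x. \<Sum>n\<in>I \<inter> {..k}. c n * \<phi> n x"
  let ?t = "\<lambda>k. \<Sum>n\<in>I \<inter> {..k}. (cmod (c n))\<^sup>2"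
  show "?s k \<in> L2 \<mu>" for k
    by (rule L2_orthonormal_span[OF on]) auto
  have norm: "(L2_norm \<mu> (\<lambda>x. ?s n x - ?s m x))\<^sup>2 = ?t n - ?t m" if "m \<le> n" for m n
  proof -
    have sub: "I \<inter> {..m} \<subseteq> I \<inter> {..n}" using that by auto
    show ?thesis
      unfolding sum_diff[OF finite_Int[OF disjI2[OF finite_atMost]] sub, symmetric]
      by (rule L2_norm_orthonormal_span[OF on]) auto
  qed
  have swap: "L2_norm \<mu> (\<lambda>x. ?s n x - ?s m x) = L2_norm \<mu> (\<lambda>x. ?s m x - ?s n x)" for m n
    by (simp add: L2_norm_def norm_minus_commute)
  fix e :: real assume "e > 0"
  moreover have "Cauchy ?t"
    using summable_on_imp_LIMSEQ[OF c] by (rule LIMSEQ_imp_Cauchy)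
  ultimately obtain M where M: "\<forall>m\<ge>M. \<forall>n\<ge>M. norm (?t m - ?t n) < e"
    using CauchyD by blast
  show "\<exists>M. \<forall>m\<ge>M. \<forall>n\<ge>M. (L2_norm \<mu> (\<lambda>x. ?s m x - ?s n x))\<^sup>2 < e"
  proof (intro exI allI impI)
    fix m n assume "M \<le> m" "M \<le> n"
    then have "\<bar>?t m - ?t n\<bar> < e" using M by auto
    then show "(L2_norm \<mu> (\<lambda>x. ?s m x - ?s n x))\<^sup>2 < e"
      using norm[of m n] norm[of n m] swap[of m n] by (cases "m \<le> n") auto
  qed
qed (use that in blast)

section \<open>Spectral decompositions\<close>

lemma spectral_orthonormal:
  "spectral_decomposition \<mu> L N ev \<phi> \<Longrightarrow> L2_orthonormal \<mu> (eig_index N) \<phi>"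
  unfolding spectral_decomposition_def L2_orthonormal_def by blast

lemma spectral_inner_expansion:
  assumes L: "L \<in> L2 \<mu> \<rightarrow> L2 \<mu>"
    and sd: "spectral_decomposition \<mu> L N ev \<phi>"
    and f: "f \<in> L2 \<mu>" and h: "h \<in> L2 \<mu>"
  shows "(\<lambda>k. \<Sum>n\<in>eig_index N \<inter> {..k}.
      of_real (ev n) * L2_inner \<mu> f (\<phi> n) * cnj (L2_inner \<mu> h (\<phi> n))) \<longlonglongrightarrow> L2_inner \<mu> (L f) h"
proof -
  note on = spectral_orthonormal[OF sd]
  have "(\<lambda>k. L2_norm \<mu> (\<lambda>x. L f x -
       (\<Sum>n\<in>eig_index N \<inter> {..k}. of_real (ev n) * L2_inner \<mu> f (\<phi> n) * \<phi> n x))) \<longlonglongrightarrow> 0"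
    using sd f unfolding spectral_decomposition_def by blast
  from tendsto_L2_inner[OF L2_orthonormal_span[OF on] funcset_mem[OF L f] h this]
  show ?thesis
    by (simp add: L2_inner_orthonormal_span[OF on _ h])
qed

text \<open>Pairing the expansion of \<open>L h\<close> with \<open>\<phi> m\<close> leaves the
  single term \<open>ev m\<close> times the coefficient of h, and \<open>ev m\<close> is positive.
  Conversely, if all coefficients vanish, every partial sum of the expansion is zero, hence so is
  the norm of \<open>L h\<close>.\<close>

lemma spectral_kernel_iff:
  assumes L: "L \<in> L2 \<mu> \<rightarrow> L2 \<mu>"
    and sd: "spectral_decomposition \<mu> L N ev \<phi>"
    and h: "h \<in> L2 \<mu>"
  shows "h \<in> L2_kernel \<mu> L \<longleftrightarrow> (\<forall>n\<in>eig_index N. L2_inner \<mu> h (\<phi> n) = 0)"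
proof
  note on = spectral_orthonormal[OF sd]
  assume "h \<in> L2_kernel \<mu> L"
  then have ker: "AE x in \<mu>. L h x = 0"
    by (simp add: L2_kernel_def)
  show "\<forall>n\<in>eig_index N. L2_inner \<mu> h (\<phi> n) = 0"
  proof
    fix m assume m: "m \<in> eig_index N"
    then have \<phi>: "\<phi> m \<in> L2 \<mu>" and pos: "ev m > 0"
      using on sd by (auto simp: L2_orthonormal_def spectral_decomposition_def)
    have "(\<Sum>n\<in>eig_index N \<inter> {..k}.
        of_real (ev n) * L2_inner \<mu> h (\<phi> n) * cnj (L2_inner \<mu> (\<phi> m) (\<phi> n)))
      = of_real (ev m) * L2_inner \<mu> h (\<phi> m)" if "m \<le> k" for k
    proof -
      have "(\<Sum>n\<in>eig_index N \<inter> {..k}.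
          of_real (ev n) * L2_inner \<mu> h (\<phi> n) * cnj (L2_inner \<mu> (\<phi> m) (\<phi> n)))
        = (\<Sum>n\<in>eig_index N \<inter> {..k}. if n = m then of_real (ev n) * L2_inner \<mu> h (\<phi> n) else 0)"
        by (rule sum.cong) (use on m in \<open>auto simp: L2_orthonormal_def\<close>)
      then show ?thesis using that m by simp
    qed
    \<comment> \<open>The partial sums are constant from k = m on.\<close>
    then have "(\<lambda>k. \<Sum>n\<in>eig_index N \<inter> {..k}.
        of_real (ev n) * L2_inner \<mu> h (\<phi> n) * cnj (L2_inner \<mu> (\<phi> m) (\<phi> n)))
      \<longlonglongrightarrow> of_real (ev m) * L2_inner \<mu> h (\<phi> m)"
      by (intro tendsto_eventually eventually_sequentiallyI)
    moreover have "L2_inner \<mu> (L h) (\<phi> m) = 0"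
      using L2_inner_cong_AE[OF funcset_mem[OF L h] L2_zero \<phi> ker] by (simp add: L2_inner_def)
    ultimately have "of_real (ev m) * L2_inner \<mu> h (\<phi> m) = 0"
      using LIMSEQ_unique[OF _ spectral_inner_expansion[OF L sd h \<phi>]] by simp
    then show "L2_inner \<mu> h (\<phi> m) = 0"
      using pos by simp
  qed
next
  assume 0: "\<forall>n\<in>eig_index N. L2_inner \<mu> h (\<phi> n) = 0"
  have "(\<lambda>k. L2_norm \<mu> (\<lambda>x. L h x -
       (\<Sum>n\<in>eig_index N \<inter> {..k}. of_real (ev n) * L2_inner \<mu> h (\<phi> n) * \<phi> n x))) \<longlonglongrightarrow> 0"
    using sd h unfolding spectral_decomposition_def by blast
  then have "(\<lambda>k::nat. L2_norm \<mu> (L h)) \<longlonglongrightarrow> 0"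
    using 0 by simp
  then have "L2_norm \<mu> (L h) = 0"
    using LIMSEQ_unique tendsto_const by blast
  then show "h \<in> L2_kernel \<mu> L"
    using L2_norm_eq_0_iff[OF funcset_mem[OF L h]] h by (simp add: L2_kernel_def)
qed

text \<open>Let g be the L2 sum of the expansion of f in the eigenfunctions. Then f - g has no
  coefficients left, so it lies in the kernel, while g is orthogonal to the kernel. Thus f - g
  represents the projection, and its norm follows because the inner product of f and g equals the
  squared norm of g.\<close>

lemma L2_norm_proj_kernel:
  assumes L: "L \<in> L2 \<mu> \<rightarrow> L2 \<mu>"
    and sd: "spectral_decomposition \<mu> L N ev \<phi>"
    and f: "f \<in> L2 \<mu>"
  shows "(L2_norm \<mu> (L2_proj \<mu> (L2_kernel \<mu> L) f))\<^sup>2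
    = (L2_norm \<mu> f)\<^sup>2 - (\<Sum>\<^sub>\<infinity>n\<in>eig_index N. (cmod (L2_inner \<mu> f (\<phi> n)))\<^sup>2)"
proof -
  note on = spectral_orthonormal[OF sd]
  note kernel_iff = spectral_kernel_iff[OF L sd]
  define c where "c n = L2_inner \<mu> f (\<phi> n)" for n
  let ?a = "\<Sum>\<^sub>\<infinity>n\<in>eig_index N. (cmod (c n))\<^sup>2"
  have c: "(\<lambda>n. (cmod (c n))\<^sup>2) summable_on eig_index N"
    unfolding c_def by (rule L2_Bessel_summable[OF on f])
  obtain g where g: "g \<in> L2 \<mu>"
    and lim: "(\<lambda>k. L2_norm \<mu> (\<lambda>x. g x - (\<Sum>n\<in>eig_index N \<inter> {..k}. c n * \<phi> n x))) \<longlonglongrightarrow> 0"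
    using L2_Riesz_Fischer[OF on c] by blast
  have inner: "(\<lambda>k. \<Sum>n\<in>eig_index N \<inter> {..k}. c n * cnj (L2_inner \<mu> h (\<phi> n))) \<longlonglongrightarrow> L2_inner \<mu> g h"
    if h: "h \<in> L2 \<mu>" for h
    using tendsto_L2_inner[OF L2_orthonormal_span[OF on] g h lim]
    by (simp add: L2_inner_orthonormal_span[OF on _ h])
  have coeff: "L2_inner \<mu> g (\<phi> m) = c m" if m: "m \<in> eig_index N" for m
  proof -
    have "(\<Sum>n\<in>eig_index N \<inter> {..k}. c n * cnj (L2_inner \<mu> (\<phi> m) (\<phi> n))) = c m" if "m \<le> k" for k
      using L2_inner_orthonormal_coeff[OF on _ _ m, of "eig_index N \<inter> {..k}" c] that m
        L2_inner_orthonormal_span[OF on _ L2_orthonormal_L2[OF on m], of "eig_index N \<inter> {..k}" c]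
      by simp
    then have "(\<lambda>k. \<Sum>n\<in>eig_index N \<inter> {..k}. c n * cnj (L2_inner \<mu> (\<phi> m) (\<phi> n))) \<longlonglongrightarrow> c m"
      by (intro tendsto_eventually eventually_sequentiallyI)
    then show ?thesis
      using inner[OF L2_orthonormal_L2[OF on m]] LIMSEQ_unique by blast
  qed
  \<comment> \<open>The inner product with g depends on h only through its coefficients. The
    functions f and g have the same ones, so this serves for h = f and for h = g.\<close>
  have g_sum: "L2_inner \<mu> g h = of_real ?a"
    if h: "h \<in> L2 \<mu>" and hc: "\<And>n. n \<in> eig_index N \<Longrightarrow> L2_inner \<mu> h (\<phi> n) = c n" for h
  proof -
    have "(\<lambda>k. complex_of_real (\<Sum>n\<in>eig_index N \<inter> {..k}. (cmod (c n))\<^sup>2)) \<longlonglongrightarrow> of_real ?a"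
      by (intro tendsto_of_real summable_on_imp_LIMSEQ c)
    moreover have "complex_of_real (\<Sum>n\<in>eig_index N \<inter> {..k}. (cmod (c n))\<^sup>2)
        = (\<Sum>n\<in>eig_index N \<inter> {..k}. c n * cnj (L2_inner \<mu> h (\<phi> n)))" for k
      unfolding of_real_sum complex_norm_square by (rule sum.cong) (auto simp: hc)
    ultimately show ?thesis
      using inner[OF h] LIMSEQ_unique by simp
  qed
  define q where "q x = f x - g x" for x
  have q: "q \<in> L2 \<mu>" unfolding q_def by (rule L2_diff[OF f g])
  have "q \<in> L2_kernel \<mu> L"
    unfolding kernel_iff[OF q] unfolding q_def
    by (auto simp: L2_inner_diff_left f g L2_orthonormal_L2[OF on] coeff c_def)
  moreover have q_orth: "L2_inner \<mu> (\<lambda>x. f x - q x) h = 0" if "h \<in> L2_kernel \<mu> L" for h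
  proof -
    have h: "h \<in> L2 \<mu>" using that by (simp add: L2_kernel_def)
    then have "L2_inner \<mu> h (\<phi> n) = 0" if "n \<in> eig_index N" for n
      using kernel_iff \<open>h \<in> L2_kernel \<mu> L\<close> that by blast
    then have "L2_inner \<mu> g h = 0"
      using inner[OF h] LIMSEQ_unique[OF tendsto_const] by (simp add: tendsto_const_iff)
    then show ?thesis by (simp add: q_def)
  qed
  \<comment> \<open>\<open>L2_proj\<close> selects some projection, determined only up to null sets.
    The function q shows that one exists; p and q agree almost everywhere because q - p lies in the
    kernel and is orthogonal to it.\<close>
  moreover define p where "p = L2_proj \<mu> (L2_kernel \<mu> L) f"
  ultimately have p: "p \<in> L2_kernel \<mu> L"
    and p_orth: "\<And>h. h \<in> L2_kernel \<mu> L \<Longrightarrow> L2_inner \<mu> (\<lambda>x. f x - p x) h = 0"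
    using someI[of "\<lambda>p. p \<in> L2_kernel \<mu> L \<and> (\<forall>g\<in>L2_kernel \<mu> L. L2_inner \<mu> (\<lambda>x. f x - p x) g = 0)" q]
    unfolding L2_proj_def by blast+
  have pL2: "p \<in> L2 \<mu>" using p by (simp add: L2_kernel_def)
  have diff: "(\<lambda>x. q x - p x) \<in> L2 \<mu>" by (rule L2_diff[OF q pL2])
  have "(\<lambda>x. q x - p x) \<in> L2_kernel \<mu> L"
    unfolding kernel_iff[OF diff]
    using kernel_iff[OF q] kernel_iff[OF pL2] p \<open>q \<in> L2_kernel \<mu> L\<close>
    by (auto simp: L2_inner_diff_left q pL2 L2_orthonormal_L2[OF on])
  then have "L2_inner \<mu> (\<lambda>x. (f x - p x) - (f x - q x)) (\<lambda>x. q x - p x) = 0"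
    by (subst L2_inner_diff_left[OF L2_diff[OF f pL2] L2_diff[OF f q] diff])
       (simp add: p_orth q_orth)
  then have "L2_inner \<mu> (\<lambda>x. q x - p x) (\<lambda>x. q x - p x) = 0"
    by simp
  then have "L2_norm \<mu> (\<lambda>x. q x - p x) = 0"
    by (simp add: L2_inner_self)
  then have "AE x in \<mu>. q x - p x = 0"
    using L2_norm_eq_0_iff[OF diff] by blast
  then have "L2_norm \<mu> p = L2_norm \<mu> q"
    unfolding L2_norm_def
    by (intro arg_cong[where f = sqrt] integral_cong_AE)
       (use q pL2 in \<open>auto simp: L2_def\<close>)
  moreover have "(L2_norm \<mu> q)\<^sup>2 = (L2_norm \<mu> f)\<^sup>2 - ?a"
  proof -
    have "L2_inner \<mu> g f = of_real ?a"
      by (rule g_sum[OF f]) (simp add: c_def)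
    then have "L2_inner \<mu> f g = of_real ?a"
      by (subst L2_inner_commute) simp
    moreover have "complex_of_real ((L2_norm \<mu> g)\<^sup>2) = of_real ?a"
      unfolding L2_inner_self[symmetric] by (rule g_sum[OF g coeff])
    ultimately show ?thesis
      unfolding q_def L2_norm_diff_power2[OF f g] of_real_eq_iff by simp
  qed
  ultimately show ?thesis
    by (simp add: p_def c_def)
qed

section \<open>The quadratic form of L and the numbering of its large eigenvalues\<close>

lemma has_sum_diff:
  fixes f g :: "'i \<Rightarrow> 'b::topological_ab_group_add"
  assumes "(f has_sum a) A" "(g has_sum b) A"
  shows "((\<lambda>x. f x - g x) has_sum (a - b)) A"
  using has_sum_add[of f A a "\<lambda>x. - g x" "- b"] assms by (simp add: has_sum_uminus)

text \<open>Since the eigenvalues are at most 1, Bessel's inequality gives summability. The value of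
  the unordered sum is then read off from the ordered expansion of \<open>L f\<close> paired with
  f.\<close>

lemma spectral_energy:
  assumes L: "L \<in> L2 \<mu> \<rightarrow> L2 \<mu>"
    and sd: "spectral_decomposition \<mu> L N ev \<phi>"
    and le1: "\<forall>n\<in>eig_index N. ev n \<le> 1"
    and f: "f \<in> L2 \<mu>"
  shows "((\<lambda>n. ev n * (cmod (L2_inner \<mu> f (\<phi> n)))\<^sup>2) has_sum Re (L2_inner \<mu> (L f) f)) (eig_index N)"
proof -
  let ?g = "\<lambda>n. ev n * (cmod (L2_inner \<mu> f (\<phi> n)))\<^sup>2"
  have pos: "ev n > 0" if "n \<in> eig_index N" for n
    using sd that by (simp add: spectral_decomposition_def)
  have summable: "?g summable_on eig_index N"
    by (rule summable_on_comparison_test[OF L2_Bessel_summable[OF spectral_orthonormal[OF sd] f]])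
       (use le1 in \<open>auto intro!: mult_left_le_one_le mult_nonneg_nonneg less_imp_le[OF pos]\<close>)
  have "(\<lambda>k. Re (\<Sum>n\<in>eig_index N \<inter> {..k}.
      of_real (ev n) * L2_inner \<mu> f (\<phi> n) * cnj (L2_inner \<mu> f (\<phi> n)))) \<longlonglongrightarrow> Re (L2_inner \<mu> (L f) f)"
    by (intro tendsto_Re spectral_inner_expansion[OF L sd f f])
  moreover have "Re (of_real (ev n) * L2_inner \<mu> f (\<phi> n) * cnj (L2_inner \<mu> f (\<phi> n))) = ?g n" for n
    unfolding mult.assoc complex_norm_square[symmetric] by simp
  ultimately have "(\<lambda>k. sum ?g (eig_index N \<inter> {..k})) \<longlonglongrightarrow> Re (L2_inner \<mu> (L f) f)"
    by simp
  then have "Re (L2_inner \<mu> (L f) f) = infsum ?g (eig_index N)"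
    using summable_on_imp_LIMSEQ[OF summable] LIMSEQ_unique by blast
  then show ?thesis
    using summable by simp
qed

text \<open>\<open>eig_count\<close> is a mere cardinality; monotonicity of the eigenvalues makes
  the counted set an initial segment, so that the count can serve as a summation bound. Finiteness
  matters here: \<open>card\<close> of an infinite set is 0, and the identity would fail.\<close>

lemma eig_count_initial_segment:
  assumes mono: "\<forall>m\<in>eig_index N. \<forall>n\<in>eig_index N. m \<le> n \<longrightarrow> ev n \<le> ev m"
    and fin: "finite {n \<in> eig_index N. 1 - \<epsilon> \<le> ev n}"
  shows "{n \<in> eig_index N. 1 - \<epsilon> \<le> ev n} = {1..eig_count N ev \<epsilon>}"
proof (cases "{n \<in> eig_index N. 1 - \<epsilon> \<le> ev n} = {}")
  case True
  then show ?thesis unfolding eig_count_def True by simp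
next
  case False
  let ?A = "{n \<in> eig_index N. 1 - \<epsilon> \<le> ev n}"
  define M where "M = Max ?A"
  have M: "M \<in> ?A" unfolding M_def using fin False by (rule Max_in)
  have "m \<in> ?A" if m: "1 \<le> m" "m \<le> M" for m
  proof -
    have "enat m \<le> enat M" using m by simp
    also have "\<dots> \<le> N" using M unfolding eig_index_def by blast
    finally have "m \<in> eig_index N" using m by (simp add: eig_index_def)
    then show ?thesis using M mono m by force
  qed
  moreover have "1 \<le> m \<and> m \<le> M" if "m \<in> ?A" for m
    using fin that by (simp add: M_def eig_index_def)
  ultimately have A: "?A = {1..M}"
    unfolding set_eq_iff atLeastAtMost_iff by blast
  show ?thesis
    unfolding eig_count_def A by simp
qed

lemma eig_index_split:
  assumes "\<forall>m\<in>eig_index N. \<forall>n\<in>eig_index N. m \<le> n \<longrightarrow> ev n \<le> ev m"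
    and "finite {n \<in> eig_index N. 1 - \<epsilon> \<le> ev n}"
  shows "{1..eig_count N ev \<epsilon>} \<subseteq> eig_index N"
    and "eig_index N = {1..eig_count N ev \<epsilon>} \<union> {n \<in> eig_index N. eig_count N ev \<epsilon> < n}"
    and "\<And>n. n \<in> eig_index N \<Longrightarrow> eig_count N ev \<epsilon> < n \<Longrightarrow> ev n < 1 - \<epsilon>"
proof -
  note eq = eig_count_initial_segment[OF assms]
  show sub: "{1..eig_count N ev \<epsilon>} \<subseteq> eig_index N" using eq by blast
  show "eig_index N = {1..eig_count N ev \<epsilon>} \<union> {n \<in> eig_index N. eig_count N ev \<epsilon> < n}"
    using sub by (auto simp: eig_index_def)
  fix n assume "n \<in> eig_index N" "eig_count N ev \<epsilon> < n"
  then show "ev n < 1 - \<epsilon>" 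
    using eq unfolding set_eq_iff by (force simp: not_le[symmetric])
qed

text \<open>Once the squared norm of f is split into its kernel part and its coefficients,
  concentration says that \<open>1 - \<epsilon>\<close> times the squared norm of the kernel part,
  plus the sum of all \<open>(1 - \<epsilon> - ev n)\<close> times squared coefficients, is at most
  0. The terms up to \<open>eig_count\<close> then change sides. Summability of the tail accompanies
  the equivalence because \<open>infsum\<close> is 0 by convention on families that are not
  summable.\<close>

lemma concentration_iff_spectral:
  assumes L: "L \<in> L2 \<mu> \<rightarrow> L2 \<mu>"
    and sd: "spectral_decomposition \<mu> L N ev \<phi>"
    and le1: "\<forall>n\<in>eig_index N. ev n \<le> 1"
    and fin: "finite {n \<in> eig_index N. 1 - \<epsilon> \<le> ev n}"
    and f: "f \<in> L2 \<mu>"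
  shows "(\<lambda>n. (1 - \<epsilon> - ev n) * (cmod (L2_inner \<mu> f (\<phi> n)))\<^sup>2)
      summable_on {n \<in> eig_index N. eig_count N ev \<epsilon> < n}" (is ?summable)
    and "Re (L2_inner \<mu> (\<lambda>x. f x - L f x) f) \<le> \<epsilon> * (L2_norm \<mu> f)\<^sup>2 \<longleftrightarrow>
      (\<Sum>n=1..eig_count N ev \<epsilon>. (ev n + \<epsilon> - 1) * (cmod (L2_inner \<mu> f (\<phi> n)))\<^sup>2)
      \<ge> (1 - \<epsilon>) * (L2_norm \<mu> (L2_proj \<mu> (L2_kernel \<mu> L) f))\<^sup>2
        + (\<Sum>\<^sub>\<infinity>n\<in>{n \<in> eig_index N. eig_count N ev \<epsilon> < n}.
             (1 - \<epsilon> - ev n) * (cmod (L2_inner \<mu> f (\<phi> n)))\<^sup>2)" (is ?iff)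
proof -
  let ?c = "\<lambda>n. (cmod (L2_inner \<mu> f (\<phi> n)))\<^sup>2"
  let ?I = "eig_index N" and ?J = "{1..eig_count N ev \<epsilon>}"
    and ?T = "{n \<in> eig_index N. eig_count N ev \<epsilon> < n}"
  let ?d = "\<lambda>n. (1 - \<epsilon> - ev n) * ?c n"
  have mono: "\<forall>m\<in>?I. \<forall>n\<in>?I. m \<le> n \<longrightarrow> ev n \<le> ev m"
    using sd by (simp add: spectral_decomposition_def)
  note split = eig_index_split[OF mono fin]
  note energy = spectral_energy[OF L sd le1 f]
  have c: "(?c has_sum infsum ?c ?I) ?I"
    using L2_Bessel_summable[OF spectral_orthonormal[OF sd] f] by simp
  have d: "(?d has_sum ((1 - \<epsilon>) * infsum ?c ?I - Re (L2_inner \<mu> (L f) f))) ?I"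
    using has_sum_diff[OF has_sum_cmult_right[OF c, of "1 - \<epsilon>"] energy]
    by (simp add: left_diff_distrib)
  then have "?d summable_on ?I"
    using has_sum_imp_summable by blast
  then show tail: ?summable
    by (rule summable_on_subset) auto
  have "(?d has_sum (sum ?d ?J + infsum ?d ?T)) (?J \<union> ?T)"
    by (intro has_sum_Un_disjoint has_sum_finite has_sum_infsum tail) auto
  then have "(1 - \<epsilon>) * infsum ?c ?I - Re (L2_inner \<mu> (L f) f) = sum ?d ?J + infsum ?d ?T"
    unfolding split(2)[symmetric] using d has_sum_unique by blast
  moreover have "sum ?d ?J = - (\<Sum>n\<in>?J. (ev n + \<epsilon> - 1) * ?c n)"
    unfolding sum_negf[symmetric] by (rule sum.cong) (auto simp: algebra_simps)
  moreover have "Re (L2_inner \<mu> (\<lambda>x. f x - L f x) f) = (L2_norm \<mu> f)\<^sup>2 - Re (L2_inner \<mu> (L f) f)"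
    by (simp add: L2_inner_diff_left f funcset_mem[OF L f] L2_inner_self)
  ultimately show ?iff
    unfolding L2_norm_proj_kernel[OF L sd f] by (simp add: algebra_simps) linarith
qed

lemma concentration_approximation:
  assumes L: "L \<in> L2 \<mu> \<rightarrow> L2 \<mu>"
    and sd: "spectral_decomposition \<mu> L N ev \<phi>"
    and le1: "\<forall>n\<in>eig_index N. ev n \<le> 1"
    and fin: "finite {n \<in> eig_index N. 1 - \<epsilon>\<^sub>0 \<le> ev n}"
    and \<epsilon>\<^sub>0: "0 < \<epsilon>\<^sub>0" "\<epsilon>\<^sub>0 \<le> 1"
    and f: "f \<in> L2 \<mu>"
    and conc: "Re (L2_inner \<mu> (\<lambda>x. f x - L f x) f) \<le> \<epsilon> * (L2_norm \<mu> f)\<^sup>2"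
  shows "L2_norm \<mu> (\<lambda>x. f x - (\<Sum>n=1..eig_count N ev \<epsilon>\<^sub>0. L2_inner \<mu> f (\<phi> n) * \<phi> n x))
    \<le> sqrt (\<epsilon> / \<epsilon>\<^sub>0) * L2_norm \<mu> f"
proof -
  note on = spectral_orthonormal[OF sd]
  let ?c = "\<lambda>n. (cmod (L2_inner \<mu> f (\<phi> n)))\<^sup>2"
  let ?I = "eig_index N" and ?J = "{1..eig_count N ev \<epsilon>\<^sub>0}"
    and ?T = "{n \<in> eig_index N. eig_count N ev \<epsilon>\<^sub>0 < n}"
  let ?p = "(L2_norm \<mu> (L2_proj \<mu> (L2_kernel \<mu> L) f))\<^sup>2"
  let ?r = "L2_norm \<mu> (\<lambda>x. f x - (\<Sum>n\<in>?J. L2_inner \<mu> f (\<phi> n) * \<phi> n x))"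
  have mono: "\<forall>m\<in>?I. \<forall>n\<in>?I. m \<le> n \<longrightarrow> ev n \<le> ev m"
    using sd by (simp add: spectral_decomposition_def)
  note split = eig_index_split[OF mono fin]
  have cI: "?c summable_on ?I" by (rule L2_Bessel_summable[OF on f])
  then have cT: "?c summable_on ?T" by (rule summable_on_subset) auto
  have eI: "((\<lambda>n. (1 - ev n) * ?c n) has_sum (infsum ?c ?I - Re (L2_inner \<mu> (L f) f))) ?I"
    using has_sum_diff[OF has_sum_infsum[OF cI] spectral_energy[OF L sd le1 f]]
    by (simp add: left_diff_distrib)
  \<comment> \<open>On the tail, \<open>1 - ev n\<close> exceeds \<open>\<epsilon>\<^sub>0\<close>;
    the remaining terms on the right are nonnegative because \<open>ev n\<close> is at most
    1.\<close>
  have "\<epsilon>\<^sub>0 * infsum ?c ?T \<le> infsum ?c ?I - Re (L2_inner \<mu> (L f) f)"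
  proof (rule has_sum_mono_neutral[OF has_sum_cmult_right[OF has_sum_infsum[OF cT]] eI])
    fix n assume "n \<in> ?T \<inter> ?I"
    then show "\<epsilon>\<^sub>0 * ?c n \<le> (1 - ev n) * ?c n"
      using split(3)[of n] by (intro mult_right_mono) auto
  qed (use le1 in auto)
  \<comment> \<open>The kernel part enters the energy with weight 1, so it meets the same bound with
    factor \<open>\<epsilon>\<^sub>0\<close>.\<close>
  moreover have "\<epsilon>\<^sub>0 * ?p \<le> ?p"
    using \<epsilon>\<^sub>0 by (intro mult_left_le_one_le) auto
  moreover have "?p = (L2_norm \<mu> f)\<^sup>2 - infsum ?c ?I"
    by (rule L2_norm_proj_kernel[OF L sd f])
  moreover have "infsum ?c ?I = sum ?c ?J + infsum ?c ?T"
  proof -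
    have "(?c has_sum (sum ?c ?J + infsum ?c ?T)) (?J \<union> ?T)"
      by (intro has_sum_Un_disjoint has_sum_finite has_sum_infsum cT) auto
    then show ?thesis
      unfolding split(2)[symmetric] by (rule infsumI)
  qed
  moreover have "?r\<^sup>2 = (L2_norm \<mu> f)\<^sup>2 - sum ?c ?J"
    by (rule L2_norm_diff_partial_sum[OF on split(1) _ f]) simp
  moreover have "Re (L2_inner \<mu> (\<lambda>x. f x - L f x) f) = (L2_norm \<mu> f)\<^sup>2 - Re (L2_inner \<mu> (L f) f)"
    by (simp add: L2_inner_diff_left f funcset_mem[OF L f] L2_inner_self)
  ultimately have "\<epsilon>\<^sub>0 * (?p + infsum ?c ?T) \<le> \<epsilon> * (L2_norm \<mu> f)\<^sup>2" and "?r\<^sup>2 = ?p + infsum ?c ?T"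
    using conc unfolding distrib_left by linarith+
  then have "?r\<^sup>2 \<le> \<epsilon> / \<epsilon>\<^sub>0 * (L2_norm \<mu> f)\<^sup>2"
    using \<epsilon>\<^sub>0 by (simp add: field_simps)
  then have "sqrt (?r\<^sup>2) \<le> sqrt (\<epsilon> / \<epsilon>\<^sub>0 * (L2_norm \<mu> f)\<^sup>2)"
    by (rule real_sqrt_le_mono)
  then show ?thesis
    unfolding real_sqrt_mult real_sqrt_abs abs_of_nonneg[OF L2_norm_nonneg] .
qed

section \<open>The phase space restriction operator\<close>

lemma E_op_L2:
  assumes A: "A \<in> sets \<mu>" and f: "f \<in> L2 \<mu>"
  shows "E_op A f \<in> L2 \<mu>"
proof -
  note [measurable] = A L2_measurable[OF f]
  have [measurable]: "E_op A f \<in> borel_measurable \<mu>"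
    unfolding E_op_def[abs_def] by measurable
  have "integrable \<mu> (\<lambda>x. (cmod (E_op A f x))\<^sup>2)"
    by (rule Bochner_Integration.integrable_bound[OF L2_integrable_power2[OF f]])
       (auto simp: E_op_def indicator_def)
  then show ?thesis by (simp add: L2_def)
qed

lemma L2_inner_E_op: "L2_inner \<mu> (E_op A f) g = L2_inner \<mu> f (E_op A g)"
  unfolding L2_inner_def
  by (rule Bochner_Integration.integral_cong) (auto simp: E_op_def indicator_def)

lemma L2_inner_E_op_self: "L2_inner \<mu> (E_op A f) f = of_real ((L2_norm \<mu> (E_op A f))\<^sup>2)"
proof -
  have "E_op A (E_op A f) = E_op A f"
    by (auto simp: E_op_def indicator_def)
  then show ?thesis
    using L2_inner_E_op[of \<mu> A "E_op A f" f] by (simp add: L2_inner_self)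
qed

lemma L2_norm_E_op_le:
  assumes "A \<in> sets \<mu>" "f \<in> L2 \<mu>"
  shows "(L2_norm \<mu> (E_op A f))\<^sup>2 \<le> (L2_norm \<mu> f)\<^sup>2"
  unfolding L2_norm_power2
  by (intro integral_mono L2_integrable_power2 E_op_L2 assms) (auto simp: E_op_def indicator_def)

section \<open>Unitarity and the size of the eigenvalues\<close>

lemma unitary_L2: "unitary_on_L2 \<mu> U \<Longrightarrow> f \<in> L2 \<mu> \<Longrightarrow> U f \<in> L2 \<mu>"
  by (simp add: unitary_on_L2_def)

lemma unitary_L2_inner:
  "unitary_on_L2 \<mu> U \<Longrightarrow> f \<in> L2 \<mu> \<Longrightarrow> g \<in> L2 \<mu> \<Longrightarrow> L2_inner \<mu> (U f) (U g) = L2_inner \<mu> f g"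
  by (simp add: unitary_on_L2_def)

lemma unitary_L2_norm:
  assumes "unitary_on_L2 \<mu> U" "f \<in> L2 \<mu>"
  shows "(L2_norm \<mu> (U f))\<^sup>2 = (L2_norm \<mu> f)\<^sup>2"
  using unitary_L2_inner[OF assms assms(2)] unfolding L2_inner_self of_real_eq_iff .

lemma L2_inv_unitary:
  assumes "unitary_on_L2 \<mu> U" "g \<in> L2 \<mu>"
  shows "L2_inv \<mu> U g \<in> L2 \<mu>" and "AE x in \<mu>. U (L2_inv \<mu> U g) x = g x"
proof -
  have "\<exists>f. f \<in> L2 \<mu> \<and> (AE x in \<mu>. U f x = g x)"
    using assms unfolding unitary_on_L2_def by blast
  from someI_ex[OF this]
  show "L2_inv \<mu> U g \<in> L2 \<mu>" and "AE x in \<mu>. U (L2_inv \<mu> U g) x = g x"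
    unfolding L2_inv_def by blast+
qed

lemma L_op_L2:
  assumes "unitary_on_L2 \<mu> U" "S \<in> sets \<mu>" "\<Sigma> \<in> sets \<mu>"
  shows "L_op \<mu> U S \<Sigma> \<in> L2 \<mu> \<rightarrow> L2 \<mu>"
proof
  fix f assume "f \<in> L2 \<mu>"
  then show "L_op \<mu> U S \<Sigma> f \<in> L2 \<mu>"
    unfolding L_op_def F_op_def
    by (intro E_op_L2 L2_inv_unitary(1)[OF assms(1)] unitary_L2[OF assms(1)] assms)
qed

text \<open>Move the outer cutoff to S onto the second argument, apply U to both arguments and
  cancel it against its inverse. What remains is the quadratic form of the cutoff to \<Sigma>, which
  is idempotent and symmetric.\<close>

lemma L2_inner_L_op:
  assumes U: "unitary_on_L2 \<mu> U" and S: "S \<in> sets \<mu>" and \<Sigma>: "\<Sigma> \<in> sets \<mu>" and f: "f \<in> L2 \<mu>"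
  shows "L2_inner \<mu> (L_op \<mu> U S \<Sigma> f) f = of_real ((L2_norm \<mu> (E_op \<Sigma> (U (E_op S f))))\<^sup>2)"
proof -
  let ?g = "E_op S f"
  let ?h = "E_op \<Sigma> (U ?g)"
  have g: "?g \<in> L2 \<mu>" and Ug: "U ?g \<in> L2 \<mu>" and h: "?h \<in> L2 \<mu>"
    by (intro E_op_L2 unitary_L2[OF U] S \<Sigma> f)+
  have "L2_inner \<mu> (L_op \<mu> U S \<Sigma> f) f = L2_inner \<mu> (L2_inv \<mu> U ?h) ?g"
    unfolding L_op_def F_op_def L2_inner_E_op ..
  also have "\<dots> = L2_inner \<mu> (U (L2_inv \<mu> U ?h)) (U ?g)"
    by (rule unitary_L2_inner[symmetric, OF U L2_inv_unitary(1)[OF U h] g])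
  also have "\<dots> = L2_inner \<mu> ?h (U ?g)"
    by (rule L2_inner_cong_AE[OF unitary_L2[OF U L2_inv_unitary(1)[OF U h]] h Ug L2_inv_unitary(2)[OF U h]])
  finally show ?thesis
    unfolding L2_inner_E_op_self .
qed

text \<open>Evaluate the quadratic form at the normalized eigenfunction. The resulting formula turns
  sums of eigenvalues into integrals over \<Sigma>; the bound 1 holds because neither cutoff
  increases the norm and U preserves it.\<close>

lemma eigenvalue_L_op:
  assumes U: "unitary_on_L2 \<mu> U" and S: "S \<in> sets \<mu>" and \<Sigma>: "\<Sigma> \<in> sets \<mu>"
    and sd: "spectral_decomposition \<mu> (L_op \<mu> U S \<Sigma>) N ev \<phi>"
    and n: "n \<in> eig_index N"
  shows "ev n = (L2_norm \<mu> (E_op \<Sigma> (U (E_op S (\<phi> n)))))\<^sup>2" and "ev n \<le> 1"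
proof -
  have \<phi>: "\<phi> n \<in> L2 \<mu>" and one: "L2_inner \<mu> (\<phi> n) (\<phi> n) = 1"
    and eig: "AE x in \<mu>. L_op \<mu> U S \<Sigma> (\<phi> n) x = of_real (ev n) * \<phi> n x"
    using sd n by (simp_all add: spectral_decomposition_def)
  have "L2_inner \<mu> (L_op \<mu> U S \<Sigma> (\<phi> n)) (\<phi> n) = of_real (ev n)"
    using L2_inner_cong_AE[OF funcset_mem[OF L_op_L2[OF U S \<Sigma>] \<phi>] L2_scale[OF \<phi>] \<phi> eig]
    by (simp add: L2_inner_scale_left one)
  then show ev: "ev n = (L2_norm \<mu> (E_op \<Sigma> (U (E_op S (\<phi> n)))))\<^sup>2"
    unfolding L2_inner_L_op[OF U S \<Sigma> \<phi>] of_real_eq_iff by simp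
  have "ev n \<le> (L2_norm \<mu> (U (E_op S (\<phi> n))))\<^sup>2"
    unfolding ev by (intro L2_norm_E_op_le \<Sigma> unitary_L2[OF U] E_op_L2 S \<phi>)
  also have "\<dots> \<le> (L2_norm \<mu> (\<phi> n))\<^sup>2"
    unfolding unitary_L2_norm[OF U E_op_L2[OF S \<phi>]] by (rule L2_norm_E_op_le[OF S \<phi>])
  also have "\<dots> = 1"
    using one by (simp add: L2_inner_self flip: of_real_power)
  finally show "ev n \<le> 1" .
qed

text \<open>On a set of finite measure, \<open>t \<le> 1 + t\<^sup>2\<close> yields integrability.
  This permits the assumption \<open>extends\<close>, which identifies \<T> with the integral
  transform on integrable elements of L2.\<close>

lemma integrable_E_op:
  assumes S: "S \<in> sets \<mu>" "emeasure \<mu> S < \<infinity>" and f: "f \<in> L2 \<mu>"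
  shows "integrable \<mu> (E_op S f)"
proof (rule Bochner_Integration.integrable_bound)
  show "integrable \<mu> (\<lambda>x. indicator S x + (cmod (f x))\<^sup>2)"
    using S L2_integrable_power2[OF f] by (intro Bochner_Integration.integrable_add) auto
  show "E_op S f \<in> borel_measurable \<mu>"
    by (rule L2_measurable[OF E_op_L2[OF S(1) f]])
  have "t \<le> 1 + t\<^sup>2" for t :: real
    using sum_squares_bound[of t 1] zero_le_power2[of t] unfolding mult_1_right power_one
    by linarith
  then show "AE x in \<mu>. norm (E_op S f x) \<le> norm (indicator S x + (cmod (f x))\<^sup>2)"
    by (auto simp: E_op_def indicator_def)
qed

text \<open>On functions supported in \<open>S\<close> the value of \<open>\<T>\<close> at \<open>\<xi>\<close> is the inner product with
  \<open>\<chi>\<^sub>S cnj (K(\<cdot>, \<xi>))\<close>. Bessel's inequality at each \<open>\<xi>\<close>, integrated over \<open>\<Sigma>\<close>, therefore bounds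
  the trace of \<open>L\<close>.\<close>

lemma (in integral_transform) sum_eigenvalues_le:
  assumes S: "S \<in> sets \<mu>" "emeasure \<mu> S < \<infinity>"
    and \<Sigma>: "\<Sigma> \<in> sets \<mu>" "emeasure \<mu> \<Sigma> < \<infinity>"
    and sd: "spectral_decomposition \<mu> (L_op \<mu> \<T> S \<Sigma>) N ev \<phi>"
    and F: "F \<subseteq> eig_index N" "finite F"
  shows "sum ev F \<le> cK\<^sup>2 * measure \<mu> S * measure \<mu> \<Sigma>"
proof -
  note on = spectral_orthonormal[OF sd]
  have space: "space \<mu> = \<Omega>"
    using sets_eq_imp_space_eq[OF sets_mu] by (simp add: space_restrict_space)
  have \<phi>: "\<phi> n \<in> L2 \<mu>" if "n \<in> F" for n
    using L2_orthonormal_L2[OF on] F that by blast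
  have T\<phi>: "\<T> (E_op S (\<phi> n)) \<in> L2 \<mu>" if "n \<in> F" for n
    by (intro unitary_L2[OF unitary] E_op_L2 S \<phi> that)
  define k where "k \<xi> x = indicator S x * cnj (K x \<xi>)" for \<xi> x
  have k: "k \<xi> \<in> L2 \<mu>" "(L2_norm \<mu> (k \<xi>))\<^sup>2 \<le> cK\<^sup>2 * measure \<mu> S" if \<xi>: "\<xi> \<in> \<Omega>" for \<xi>
  proof -
    \<comment> \<open>Measurability of the kernel in x comes from continuity, as the sigma-algebra
      consists of the relative Borel sets of \<Omega>.\<close>
    have "continuous_on \<Omega> (\<lambda>x. K x \<xi>)"
      using continuous_on_compose2[OF K_continuous, of \<Omega> "\<lambda>x. (x, \<xi>)"] \<xi>
      by (simp add: continuous_on_Pair image_subset_iff)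
    then have [measurable]: "(\<lambda>x. K x \<xi>) \<in> borel_measurable \<mu>"
      using borel_measurable_continuous_on_restrict measurable_cong_sets[OF sets_mu refl] by blast
    have [measurable]: "S \<in> sets \<mu>" by fact
    have le: "(cmod (k \<xi> x))\<^sup>2 \<le> cK\<^sup>2 * indicator S x" if "x \<in> space \<mu>" for x
      using power_mono[OF K_bounded[of x \<xi>], of 2] that \<xi>
      by (simp add: k_def indicator_def space)
    have int: "integrable \<mu> (\<lambda>x. cK\<^sup>2 * indicator S x)"
      using S by simp
    have "integrable \<mu> (\<lambda>x. (cmod (k \<xi> x))\<^sup>2)"
    proof (rule Bochner_Integration.integrable_bound[OF int])
      show "(\<lambda>x. (cmod (k \<xi> x))\<^sup>2) \<in> borel_measurable \<mu>"
        unfolding k_def by measurable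
    qed (use le in auto)
    then show kL2: "k \<xi> \<in> L2 \<mu>"
      unfolding L2_def k_def[abs_def] by simp
    have "(L2_norm \<mu> (k \<xi>))\<^sup>2 \<le> (\<integral>x. cK\<^sup>2 * indicator S x \<partial>\<mu>)"
      unfolding L2_norm_power2 by (intro integral_mono int L2_integrable_power2 kL2 le)
    then show "(L2_norm \<mu> (k \<xi>))\<^sup>2 \<le> cK\<^sup>2 * measure \<mu> S"
      using S by (simp add: sets.Int_space_eq2)
  qed
  \<comment> \<open>The conjugate puts \<open>k \<xi>\<close> into the first slot, where Bessel's
    inequality expects the function being expanded; the modulus does not change.\<close>
  have transform_eq: "transform \<mu> K (E_op S (\<phi> n)) \<xi> = cnj (L2_inner \<mu> (k \<xi>) (\<phi> n))" for n \<xi>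
    unfolding L2_inner_commute[of \<mu> "\<phi> n" "k \<xi>", symmetric]
    unfolding transform_def L2_inner_def
    by (rule Bochner_Integration.integral_cong) (auto simp: k_def E_op_def indicator_def)
  \<comment> \<open>Each n has its own exceptional null set; finiteness of F lets them be combined,
    so that Bessel's inequality applies to all n in F at one point.\<close>
  have "AE \<xi> in \<mu>. \<forall>n\<in>F. \<T> (E_op S (\<phi> n)) \<xi> = transform \<mu> K (E_op S (\<phi> n)) \<xi>"
    using F(2) by (intro AE_finite_allI extends integrable_E_op E_op_L2 S \<phi>)
  then have bound: "AE \<xi> in \<mu>. (\<Sum>n\<in>F. (cmod (E_op \<Sigma> (\<T> (E_op S (\<phi> n))) \<xi>))\<^sup>2)
      \<le> cK\<^sup>2 * measure \<mu> S * indicator \<Sigma> \<xi>"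
  proof (rule AE_mp, intro AE_I2 impI)
    fix \<xi>
    assume \<xi>: "\<xi> \<in> space \<mu>" and eq: "\<forall>n\<in>F. \<T> (E_op S (\<phi> n)) \<xi> = transform \<mu> K (E_op S (\<phi> n)) \<xi>"
    have "(\<Sum>n\<in>F. (cmod (\<T> (E_op S (\<phi> n)) \<xi>))\<^sup>2) = (\<Sum>n\<in>F. (cmod (L2_inner \<mu> (k \<xi>) (\<phi> n)))\<^sup>2)"
      by (rule sum.cong) (use eq in \<open>auto simp: transform_eq\<close>)
    also have "\<dots> \<le> (L2_norm \<mu> (k \<xi>))\<^sup>2"
      using \<xi> k by (intro L2_Bessel[OF on F]) (simp add: space)
    also have "\<dots> \<le> cK\<^sup>2 * measure \<mu> S"
      using \<xi> k by (simp add: space)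
    finally show "(\<Sum>n\<in>F. (cmod (E_op \<Sigma> (\<T> (E_op S (\<phi> n))) \<xi>))\<^sup>2) \<le> cK\<^sup>2 * measure \<mu> S * indicator \<Sigma> \<xi>"
      by (simp add: E_op_def indicator_def)
  qed
  have int: "integrable \<mu> (\<lambda>\<xi>. (cmod (E_op \<Sigma> (\<T> (E_op S (\<phi> n))) \<xi>))\<^sup>2)" if "n \<in> F" for n
    by (intro L2_integrable_power2 E_op_L2 \<Sigma> T\<phi> that)
  have "sum ev F = (\<Sum>n\<in>F. (L2_norm \<mu> (E_op \<Sigma> (\<T> (E_op S (\<phi> n)))))\<^sup>2)"
    by (intro sum.cong refl eigenvalue_L_op(1)[OF unitary S(1) \<Sigma>(1) sd]) (use F in auto)
  also have "\<dots> = (\<integral>\<xi>. (\<Sum>n\<in>F. (cmod (E_op \<Sigma> (\<T> (E_op S (\<phi> n))) \<xi>))\<^sup>2) \<partial>\<mu>)"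
    unfolding L2_norm_power2 by (rule Bochner_Integration.integral_sum[OF int, symmetric])
  also have "\<dots> \<le> (\<integral>\<xi>. cK\<^sup>2 * measure \<mu> S * indicator \<Sigma> \<xi> \<partial>\<mu>)"
    by (rule integral_mono_AE[OF Bochner_Integration.integrable_sum[OF int] _ bound])
       (use \<Sigma> in auto)
  also have "\<dots> = cK\<^sup>2 * measure \<mu> S * measure \<mu> \<Sigma>"
    using \<Sigma> by (simp add: sets.Int_space_eq2)
  finally show ?thesis .
qed

text \<open>If m eigenvalues are at least t, their sum is at least m t, so the trace bound limits m.
  This makes \<open>eig_count\<close> a genuine count.\<close>

lemma (in integral_transform) finite_large_eigenvalues:
  assumes S: "S \<in> sets \<mu>" "emeasure \<mu> S < \<infinity>"
    and \<Sigma>: "\<Sigma> \<in> sets \<mu>" "emeasure \<mu> \<Sigma> < \<infinity>"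
    and sd: "spectral_decomposition \<mu> (L_op \<mu> \<T> S \<Sigma>) N ev \<phi>"
    and t: "t > 0"
  shows "finite {n \<in> eig_index N. t \<le> ev n}"
proof (rule ccontr)
  let ?B = "cK\<^sup>2 * measure \<mu> S * measure \<mu> \<Sigma>"
  assume "infinite {n \<in> eig_index N. t \<le> ev n}"
  moreover obtain m :: nat where m: "?B / t < of_nat m"
    using reals_Archimedean2 by blast
  ultimately obtain F where F: "F \<subseteq> {n \<in> eig_index N. t \<le> ev n}" "finite F" "card F = m"
    using infinite_arbitrarily_large by blast
  then have "of_nat m * t \<le> sum ev F"
    by (intro sum_bounded_below[of F t ev, unfolded F(3)]) auto
  also have "\<dots> \<le> ?B"
    using F by (intro sum_eigenvalues_le[OF S \<Sigma> sd]) auto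
  finally show False
    using m t by (simp add: field_simps)
qed

theorem theoremD:
  fixes \<Omega> S \<Sigma> :: "(real ^ 'd) set"
    and \<mu> :: "(real ^ 'd) measure"
    and a cK \<epsilon> \<epsilon>\<^sub>0 :: real
    and Q :: "real ^ 'd \<Rightarrow> real"
    and K :: "real ^ 'd \<Rightarrow> real ^ 'd \<Rightarrow> complex"
    and \<T> :: "(real ^ 'd \<Rightarrow> complex) \<Rightarrow> real ^ 'd \<Rightarrow> complex"
    and N :: enat
    and ev :: "nat \<Rightarrow> real"
    and \<phi> :: "nat \<Rightarrow> real ^ 'd \<Rightarrow> complex"
  assumes "integral_transform \<Omega> \<mu> a Q K cK \<T>"
    and "S \<in> sets \<mu>" and "0 < emeasure \<mu> S" and "emeasure \<mu> S < \<infinity>"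
    and "\<Sigma> \<in> sets \<mu>" and "0 < emeasure \<mu> \<Sigma>" and "emeasure \<mu> \<Sigma> < \<infinity>"
    and "0 < \<epsilon>" and "\<epsilon> < 1" and "0 < \<epsilon>\<^sub>0" and "\<epsilon>\<^sub>0 < 1"
    and "spectral_decomposition \<mu> (L_op \<mu> \<T> S \<Sigma>) N ev \<phi>"
  shows "(\<forall>f\<in>L2 \<mu>.
            (\<lambda>n. (1 - \<epsilon> - ev n) * (cmod (L2_inner \<mu> f (\<phi> n)))\<^sup>2)
              summable_on {n \<in> eig_index N. eig_count N ev \<epsilon> < n} \<and>
            (f \<in> L2_conc \<mu> \<T> \<epsilon> S \<Sigma> \<longleftrightarrow>
              (\<Sum>n=1..eig_count N ev \<epsilon>. (ev n + \<epsilon> - 1) * (cmod (L2_inner \<mu> f (\<phi> n)))\<^sup>2)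
              \<ge> (1 - \<epsilon>) * (L2_norm \<mu> (L2_proj \<mu> (L2_kernel \<mu> (L_op \<mu> \<T> S \<Sigma>)) f))\<^sup>2
                + (\<Sum>\<^sub>\<infinity>n\<in>{n \<in> eig_index N. eig_count N ev \<epsilon> < n}.
                     (1 - \<epsilon> - ev n) * (cmod (L2_inner \<mu> f (\<phi> n)))\<^sup>2))) \<and>
         (\<forall>f\<in>L2_conc \<mu> \<T> \<epsilon> S \<Sigma>.
            L2_norm \<mu> (\<lambda>x. f x - (\<Sum>n=1..eig_count N ev \<epsilon>\<^sub>0. L2_inner \<mu> f (\<phi> n) * \<phi> n x))
              \<le> sqrt (\<epsilon> / \<epsilon>\<^sub>0) * L2_norm \<mu> f)"
proof -
  interpret integral_transform \<Omega> \<mu> a Q K cK \<T> by fact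
  note L = L_op_L2[OF unitary \<open>S \<in> sets \<mu>\<close> \<open>\<Sigma> \<in> sets \<mu>\<close>]
  note sd = \<open>spectral_decomposition \<mu> (L_op \<mu> \<T> S \<Sigma>) N ev \<phi>\<close>
  have le1: "\<forall>n\<in>eig_index N. ev n \<le> 1"
    using eigenvalue_L_op(2)[OF unitary \<open>S \<in> sets \<mu>\<close> \<open>\<Sigma> \<in> sets \<mu>\<close> sd] by blast
  \<comment> \<open>The threshold \<open>1 - e\<close> is positive exactly because e is less than 1,
    as the trace bound requires.\<close>
  have fin: "finite {n \<in> eig_index N. 1 - e \<le> ev n}" if "e < 1" for e
    using finite_large_eigenvalues[OF \<open>S \<in> sets \<mu>\<close> \<open>emeasure \<mu> S < \<infinity>\<close>
        \<open>\<Sigma> \<in> sets \<mu>\<close> \<open>emeasure \<mu> \<Sigma> < \<infinity>\<close> sd] that by simp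
  show ?thesis
    using concentration_iff_spectral[OF L sd le1 fin[OF \<open>\<epsilon> < 1\<close>]]
      concentration_approximation[OF L sd le1 fin[OF \<open>\<epsilon>\<^sub>0 < 1\<close>]] assms(10,11)
    by (auto simp: L2_conc_def)
qed

end
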